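(* Let $h\ge 2$ be an integer and let $q$ be the product of all primes $p\le h^4$. Then \[V_3(q;h)\ll h(\log h)^4(\log\log h)^2.\]
   Context: $\mu$ is the Möbius function, $\phi$ Euler's totient, $e(x)=e^{2\pi i x}$. For a squarefree positive integer $q$, \[V_3(q;h)=\sum_{\substack{d_1,d_2,d_3\in\mathbb Z\\1\le d_i\le h}}\ \sum_{\substack{q_1,q_2,q_3\\ 1<q_i\mid q}}\Big(\prod_{i=1}^3\frac{\mu(q_i)}{\phi(q_i)}\Big)\sum_{\substack{a_1,a_2,a_3\\ 1\le a_i\le q_i,\ \gcd(a_i,q_i)=1\\ \sum_i a_i/q_i\in\mathbb Z}}e\Big(\sum_{i=1}^3\frac{a_id_i}{q_i}\Big).\] The implied constant is absolute. *)

theory Defs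
  imports Complex_Main "HOL-Computational_Algebra.Squarefree" "HOL-Number_Theory.Totient"
begin

definition moebius_mu :: "nat \<Rightarrow> real" where
  "moebius_mu n = (if squarefree n then (-1) ^ card (prime_factors n) else 0)"

definition unit_exp :: "real \<Rightarrow> complex" where
  "unit_exp x = exp (2 * of_real pi * \<i> * of_real x)"

definition nontrivial_divisors :: "nat \<Rightarrow> nat set" where
  "nontrivial_divisors q = {r. 1 < r \<and> r dvd q}"

definition residue_triples :: "nat \<Rightarrow> nat \<Rightarrow> nat \<Rightarrow> (nat \<times> nat \<times> nat) set" where
  "residue_triples q1 q2 q3 =
     {(a1, a2, a3).
        (1 \<le> a1 \<and> a1 \<le> q1 \<and> gcd a1 q1 = 1) \<and>
        (1 \<le> a2 \<and> a2 \<le> q2 \<and> gcd a2 q2 = 1) \<and>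
        (1 \<le> a3 \<and> a3 \<le> q3 \<and> gcd a3 q3 = 1) \<and>
        real a1 / real q1 + real a2 / real q2 + real a3 / real q3 \<in> \<int>}"

text \<open>Intended for squarefree positive \<open>q\<close>; for \<open>q = 0\<close> the set of divisors is infinite
  and the sum takes the junk value 0.\<close>

definition V3 :: "nat \<Rightarrow> nat \<Rightarrow> complex" where
  "V3 q h =
     (\<Sum>d1\<in>{1..int h}. \<Sum>d2\<in>{1..int h}. \<Sum>d3\<in>{1..int h}.
       \<Sum>q1\<in>nontrivial_divisors q. \<Sum>q2\<in>nontrivial_divisors q. \<Sum>q3\<in>nontrivial_divisors q.
         of_real ((moebius_mu q1 / real (totient q1)) *
                  (moebius_mu q2 / real (totient q2)) *
                  (moebius_mu q3 / real (totient q3))) *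
         (\<Sum>(a1, a2, a3)\<in>residue_triples q1 q2 q3.
            unit_exp (real a1 * of_int d1 / real q1 +
               real a2 * of_int d2 / real q2 +
               real a3 * of_int d3 / real q3)))"

end

theory Submission
  imports Defs
begin

text \<open>
  Put $F(a/q) = \min(h, 1/\|a/q\|)$, so that each inner sum over $d_i$ is at most $F(a_i/q_i)$ in
  absolute value. The condition $\sum a_i/q_i \in \mathbb{Z}$ forces $q_1 = gyz$, $q_2 = gxz$,
  $q_3 = gxy$ with $g, x, y, z$ pairwise coprime, and by the triangle inequality
  $F_1 F_2 F_3 \le 2((F_1F_3)^{3/2} + (F_2F_3)^{3/2})$. Since any two indices may be exchanged, we
  may take $z$ to be the largest of $x, y, z$, so that it suffices to sum $(F_1F_3)^{3/2}$
  subject to $y \le z$. The only constraint used is $a_1 x + a_3 z \equiv 0 \pmod y$.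

  If $gz \ge h$, fix $a_3$: then $a_1$ runs through a residue class modulo $y$, and the sum of
  $F_1^{3/2}$ is $\ll gz\sqrt h$. If $gz < h$, let $z$ run through a dyadic interval and
  fix $a_1$ and $a_3$: then $z$ lies in a residue class modulo $y \le z$. Here $1/\phi(z)^2$ is
  replaced by $(\log\log h)^2/z^2$, and there are $\ll \log h$ dyadic intervals. In
  both cases summing over the remaining parameters gives $h$ times four factors $\ll \log h$,
  each being $\sum_{n \mid q} n^2/\phi(n)^3$ or the number of dyadic intervals.
\<close>

section \<open>Sums over primes and divisors of primorials\<close>

text \<open>The exponent 3/2 has two reasons. It exceeds 1, so the sum of min(h, Q/b)^(3/2) over b
  is O(Q sqrt(h)), without the logarithm that exponent 1 would cost; and the two sums that remain,
  over a_1 and a_3, contribute sqrt(h) each, which makes the h of the theorem. The third factor has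
  to go because a_2 is determined by a_1 and a_3, so no free sum is left for it. The split at gz = h
  comes from numerators within y of 0 or of the denominator. Such a numerator may contribute h^(3/2)
  by itself, which gz sqrt(h) absorbs just when gz >= h. For smaller gz the saving must come from
  averaging over z: a residue class modulo y has at most R/y + 1 members below R, which is O(R/y)
  once y <= R, and taking z largest provides this. The averaging wants a smooth weight in z, hence
  the loss in exchanging phi(z) for z. The limit h^4 enters through log(h^4) = 4 log h. Since log
  log h is negative at h = 2 and changes sign at e, the estimates carry ln(ln h + 3) >= 1, compared
  with |ln ln h| at the end.\<close>

lemma sum_divisors_prod_primes:
  fixes f :: "nat \<Rightarrow> real"
  assumes "finite P" "\<And>p. p \<in> P \<Longrightarrow> prime p" and f1: "f 1 = 1"
    and fm: "\<And>p n. prime p \<Longrightarrow> coprime p n \<Longrightarrow> f (p * n) = f p * f n"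
  shows "(\<Sum>d | d dvd \<Prod>P. f d) = (\<Prod>p\<in>P. 1 + f p)"
  using assms(1,2)
proof (induction P rule: finite_induct)
  case empty
  then show ?case using f1 by simp
next
  case (insert p P)
  let ?m = "\<Prod>P"
  have p: "prime p" using insert by auto
  have m: "?m > 0" using insert by (auto intro!: prod_pos prime_gt_0_nat)
  have cop: "coprime p ?m"
    using insert p by (intro prod_coprime_right) (auto intro!: primes_coprime)
  have fin: "finite {d. d dvd ?m}" using m by simp
  \<comment> \<open>Divisors without and with the factor \<open>p\<close>. The two parts are
    disjoint because \<open>p\<close> is coprime to \<open>?m\<close>, so passing from
    \<open>P\<close> to \<open>insert p P\<close> multiplies the sum by
    \<open>1 + f p\<close>.\<close>
  have "{d. d dvd p * ?m} = {d. d dvd ?m} \<union> (*) p ` {d. d dvd ?m}"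
  proof (intro equalityI subsetI)
    fix d assume d: "d \<in> {d. d dvd p * ?m}"
    show "d \<in> {d. d dvd ?m} \<union> (*) p ` {d. d dvd ?m}"
    proof (cases "p dvd d")
      case True
      then obtain e where "d = p * e" by auto
      then show ?thesis using d p by auto
    next
      case False
      then have "coprime p d" using p prime_imp_coprime by blast
      then show ?thesis using d by (auto simp: coprime_commute coprime_dvd_mult_right_iff)
    qed
  qed auto
  moreover have "{d. d dvd ?m} \<inter> (*) p ` {d. d dvd ?m} = {}"
    using cop p by (metis (no_types, lifting) coprime_absorb_left disjoint_iff dvd_mult_left
        image_iff mem_Collect_eq not_prime_unit)
  ultimately have "(\<Sum>d | d dvd p * ?m. f d) = (\<Sum>d | d dvd ?m. f d) + (\<Sum>d\<in>(*) p ` {d. d dvd ?m}. f d)"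
    using fin by (simp add: sum.union_disjoint)
  also have "(\<Sum>d\<in>(*) p ` {d. d dvd ?m}. f d) = (\<Sum>d | d dvd ?m. f (p * d))"
    using p by (subst sum.reindex) (auto simp: inj_on_def)
  also have "\<dots> = (\<Sum>d | d dvd ?m. f p * f d)"
    using p cop by (intro sum.cong refl fm) (auto elim: coprime_divisors[rotated 2])
  also have "\<dots> = f p * (\<Sum>d | d dvd ?m. f d)" by (simp add: sum_distrib_left)
  finally show ?case using insert by (simp add: algebra_simps)
qed

text \<open>A discrete integral test: \<open>ln x \<le> x - 1\<close> gives e (n+1)^(-1-e) <= n^(-e)
  - (n+1)^(-e), which telescopes. The explicit dependence on \<open>e\<close> matters, since
  \<open>e\<close> is later chosen as 1 / ln N.\<close>

lemma sum_inverse_powr_le: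
  fixes e :: real
  assumes e: "e > 0"
  shows "(\<Sum>n=1..N. real n powr (-(1 + e))) \<le> 1 + 1 / e"
proof -
  have step: "real (Suc n) powr (-(1 + e)) \<le> (real n powr (-e) - real (Suc n) powr (-e)) / e"
    if n: "n \<ge> 1" for n
  proof -
    have "ln (real n / real (Suc n)) \<le> real n / real (Suc n) - 1"
      using n by (intro ln_le_minus_one) auto
    then have l: "ln (real (Suc n)) - ln (real n) \<ge> 1 / real (Suc n)"
      using n by (simp add: ln_div field_simps)
    have "real n powr (-e) = real (Suc n) powr (-e) * exp (e * (ln (real (Suc n)) - ln (real n)))"
      using n by (simp add: powr_def flip: exp_add) (simp add: algebra_simps)
    moreover have "exp (e * (ln (real (Suc n)) - ln (real n))) \<ge> 1 + e * (1 / real (Suc n))"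
      using exp_ge_add_one_self[of "e * (ln (real (Suc n)) - ln (real n))"]
        mult_left_mono[OF l, of e] e by linarith
    ultimately have "real n powr (-e) \<ge> real (Suc n) powr (-e) * (1 + e * (1 / real (Suc n)))"
      by (simp add: mult_left_mono)
    moreover have "real (Suc n) powr (-(1 + e)) = real (Suc n) powr (-e) / real (Suc n)"
      using powr_add[of "real (Suc n)" "-e" "-1"] by (simp add: powr_minus_divide add.commute)
    ultimately have "e * real (Suc n) powr (-(1 + e)) \<le> real n powr (-e) - real (Suc n) powr (-e)"
      by (simp only: distrib_left mult_1_right times_divide_eq_right times_divide_eq_left mult.commute mult_1_left)
    then show ?thesis using e by (simp add: pos_le_divide_eq mult.commute)
  qed
  have "(\<Sum>n=1..N. real n powr (-(1 + e))) \<le> 1 + (1 - real N powr (-e)) / e" if "N \<ge> 1"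
    using that
  proof (induction N rule: dec_induct)
    case (step n)
    have "(\<Sum>k=1..Suc n. real k powr (-(1 + e))) \<le> 1 + (1 - real n powr (-e)) / e + real (Suc n) powr (-(1 + e))"
      using step by simp
    also have "\<dots> \<le> 1 + (1 - real n powr (-e)) / e + (real n powr (-e) - real (Suc n) powr (-e)) / e"
      using \<open>\<And>n. 1 \<le> n \<Longrightarrow> real (Suc n) powr (-(1 + e)) \<le> _ n\<close> step by simp
    also have "\<dots> = 1 + (1 - real (Suc n) powr (-e)) / e" by (simp add: diff_divide_distrib)
    finally show ?case .
  qed simp
  moreover have "(1 - real N powr (-e)) / e \<le> 1 / e" using e by (intro divide_right_mono) auto
  ultimately show ?thesis using e by (cases "N = 0") auto
qed

lemma sum_inverse_squares_le:
  fixes A :: "nat set"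
  assumes "finite A" "\<And>n. n \<in> A \<Longrightarrow> n > 0"
  shows "(\<Sum>n\<in>A. 1 / real n ^ 2) \<le> 2"
proof -
  have "(\<Sum>n\<in>A. 1 / real n ^ 2) \<le> (\<Sum>n=1..Max (insert 1 A). 1 / real n ^ 2)"
    using assms by (intro sum_mono2) (auto simp: Suc_le_eq intro!: Max_ge)
  also have "\<dots> = (\<Sum>n=1..Max (insert 1 A). real n powr (-(1 + 1)))"
    by (intro sum.cong refl) (simp add: powr_minus_divide powr_numeral)
  also have "\<dots> \<le> 1 + 1 / 1" by (rule sum_inverse_powr_le) simp
  finally show ?thesis by simp
qed

lemma ln_nat_ge_half:
  fixes n :: nat
  assumes "n \<ge> 2"
  shows "ln (real n) \<ge> 1 / 2"
proof -
  have "ln (1 / 2 :: real) \<le> 1 / 2 - 1" by (rule ln_le_minus_one) simp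
  moreover have "ln (real n) \<ge> ln 2" using assms by (intro ln_mono) auto
  ultimately show ?thesis by (simp add: ln_div)
qed

definition primes_upto :: "nat \<Rightarrow> nat set" where
  "primes_upto N = {p. prime p \<and> p \<le> N}"

lemma finite_primes_upto [simp]: "finite (primes_upto N)"
  unfolding primes_upto_def by (rule finite_subset[of _ "{..N}"]) auto

lemma primes_uptoD: "p \<in> primes_upto N \<Longrightarrow> prime p \<and> 2 \<le> p \<and> p \<le> N"
  unfolding primes_upto_def by (auto dest: prime_ge_2_nat)

lemma primorial_pos: "\<Prod>(primes_upto N) > 0"
  by (intro prod_pos) (auto dest: primes_uptoD)

text \<open>A one-sided Mertens estimate by double counting. The sum of ln p * floor(N/p) equals the
  sum over n <= N of the logarithm of the radical of n, which is at most N ln N. Passing from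
  floor(N/p) to N/p costs the sum of ln p, again at most N ln N trivially; hence the factor
  2.\<close>

lemma sum_ln_primes_div_le:
  assumes "N \<ge> 1"
  shows "(\<Sum>p\<in>primes_upto N. ln (real p) / real p) \<le> 2 * ln (real N)"
proof -
  have rad: "(\<Sum>p | prime p \<and> p dvd n. ln (real p)) \<le> ln (real n)" if n: "n \<ge> 1" for n
  proof -
    have pf: "{p. prime p \<and> p dvd n} = prime_factors n"
      using n by (auto simp: prime_factors_dvd)
    have "(\<Prod>p\<in>prime_factors n. p) dvd n"
      using n prod_prime_factors[of n] prod_dvd_prod[of "prime_factors n" "\<lambda>p. p" "\<lambda>p. p ^ multiplicity p n"]
      by (metis (no_types, lifting) dvd_power dvd_refl mult_is_0 n neq0_conv normalize_nat_def id_apply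
          not_one_le_zero prime_factors_multiplicity mem_Collect_eq)
    then have "(\<Prod>p\<in>prime_factors n. p) \<le> n" using n by (intro dvd_imp_le) auto
    moreover have "(\<Prod>p\<in>prime_factors n. p) > 0" by (intro prod_pos) (auto intro: prime_gt_0_nat)
    ultimately have "ln (real (\<Prod>p\<in>prime_factors n. p)) \<le> ln (real n)"
      by (intro ln_mono) (simp_all only: of_nat_0_less_iff of_nat_le_iff)
    moreover have "ln (real (\<Prod>p\<in>prime_factors n. p)) = (\<Sum>p\<in>prime_factors n. ln (real p))"
      by (simp, subst ln_prod) (auto intro: prime_gt_0_nat)
    ultimately show ?thesis unfolding pf by simp
  qed
  have "(\<Sum>p\<in>primes_upto N. ln (real p) * real (N div p))
      = (\<Sum>p\<in>primes_upto N. \<Sum>n\<in>{1..N}. if p dvd n then ln (real p) else 0)"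
  proof (intro sum.cong refl)
    fix p assume "p \<in> primes_upto N"
    then have p: "p > 0" using primes_uptoD by fastforce
    have "{n\<in>{1..N}. p dvd n} = (*) p ` {1..N div p}"
    proof (intro equalityI subsetI)
      fix n assume "n \<in> {n\<in>{1..N}. p dvd n}"
      then obtain k where "n = p * k" "1 \<le> n" "n \<le> N" by auto
      then show "n \<in> (*) p ` {1..N div p}" using p
        by (auto simp: less_eq_div_iff_mult_less_eq mult.commute intro!: image_eqI[of _ _ k])
    next
      fix n assume "n \<in> (*) p ` {1..N div p}"
      then show "n \<in> {n\<in>{1..N}. p dvd n}" using p
        by (auto simp: less_eq_div_iff_mult_less_eq mult.commute)
    qed
    then have "card {n\<in>{1..N}. p dvd n} = N div p"
      using p by (simp add: card_image inj_on_def)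
    then show "ln (real p) * real (N div p) = (\<Sum>n\<in>{1..N}. if p dvd n then ln (real p) else 0)"
      by (simp add: sum.If_cases Int_def)
  qed
  also have "\<dots> = (\<Sum>n\<in>{1..N}. \<Sum>p\<in>primes_upto N. if p dvd n then ln (real p) else 0)"
    by (rule sum.swap)
  also have "\<dots> = (\<Sum>n\<in>{1..N}. \<Sum>p | prime p \<and> p dvd n. ln (real p))"
  proof (rule sum.cong[OF refl])
    fix n assume "n \<in> {1..N}"
    then have "primes_upto N \<inter> {p. p dvd n} = {p. prime p \<and> p dvd n}"
      by (auto simp: primes_upto_def dest: dvd_imp_le)
    then show "(\<Sum>p\<in>primes_upto N. if p dvd n then ln (real p) else 0) = (\<Sum>p | prime p \<and> p dvd n. ln (real p))"
      by (simp add: sum.If_cases Int_def)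
  qed
  also have "\<dots> \<le> (\<Sum>n\<in>{1..N}. ln (real N))"
  proof (rule sum_mono)
    fix n assume "n \<in> {1..N}"
    then have "n \<ge> 1" "ln (real n) \<le> ln (real N)" by (auto intro!: ln_mono)
    then show "(\<Sum>p | prime p \<and> p dvd n. ln (real p)) \<le> ln (real N)"
      using rad[of n] by linarith
  qed
  also have "\<dots> = real N * ln (real N)" by simp
  finally have 1: "(\<Sum>p\<in>primes_upto N. ln (real p) * real (N div p)) \<le> real N * ln (real N)" .
  have 2: "(\<Sum>p\<in>primes_upto N. ln (real p)) \<le> real N * ln (real N)"
  proof -
    have "(\<Sum>p\<in>primes_upto N. ln (real p)) \<le> (\<Sum>p\<in>primes_upto N. ln (real N))"
      by (intro sum_mono) (use primes_uptoD in fastforce)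
    also have "\<dots> \<le> (\<Sum>p\<in>{1..N}. ln (real N))"
      using assms by (intro sum_mono2) (auto dest: primes_uptoD)
    finally show ?thesis by simp
  qed
  have "real N * (\<Sum>p\<in>primes_upto N. ln (real p) / real p)
     \<le> (\<Sum>p\<in>primes_upto N. ln (real p) * real (N div p) + ln (real p))"
    unfolding sum_distrib_left
  proof (rule sum_mono)
    fix p assume "p \<in> primes_upto N"
    then have p: "p \<ge> 2" using primes_uptoD by auto
    have "N \<le> p * (N div p + 1)"
      using dividend_less_div_times[of p N] p by (simp add: mult.commute add.commute)
    then have "real N \<le> real p * (real (N div p) + 1)"
      by (metis of_nat_1 of_nat_add of_nat_le_iff of_nat_mult)
    then have "real N / real p \<le> real (N div p) + 1"
      using p by (simp add: divide_le_eq mult.commute)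
    then have "ln (real p) * (real N / real p) \<le> ln (real p) * (real (N div p) + 1)"
      using p by (intro mult_left_mono) auto
    then show "real N * (ln (real p) / real p) \<le> ln (real p) * real (N div p) + ln (real p)"
      by (simp add: algebra_simps)
  qed
  also have "\<dots> \<le> real N * (2 * ln (real N))" using 1 2 by (simp add: sum.distrib)
  finally show ?thesis using assms by (simp add: mult_le_cancel_left)
qed


text \<open>Compare $1/p$ with $p^{-s}$ for $s = 1 + 1/\log N$, where the Euler product is bounded by $\zeta(s)$.\<close>

lemma sum_inverse_primes_le:
  assumes "N \<ge> 2"
  shows "(\<Sum>p\<in>primes_upto N. 1 / real p) \<le> ln (ln (real N)) + 7"
proof -
  define L where "L = ln (real N)"
  have L: "L \<ge> 1 / 2" unfolding L_def by (rule ln_nat_ge_half[OF assms])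
  define e where "e = 1 / L"
  have e: "e > 0" unfolding e_def using L by simp
  define f where "f = (\<lambda>n. real n powr (-(1 + e)))"
  let ?P = "primes_upto N"
  have fpos: "f p > 0" if "p \<in> ?P" for p using primes_uptoD[OF that] by (simp add: f_def)
  have euler: "(\<Prod>p\<in>?P. 1 + f p) \<le> 1 + L"
  proof -
    have "(\<Prod>p\<in>?P. 1 + f p) = (\<Sum>d | d dvd \<Prod>?P. f d)"
      by (rule sum_divisors_prod_primes[symmetric])
        (auto simp: f_def powr_mult dest: primes_uptoD)
    also have "\<dots> \<le> (\<Sum>d=1..\<Prod>?P. f d)"
    proof (rule sum_mono2)
      show "{d. d dvd \<Prod>?P} \<subseteq> {1..\<Prod>?P}"
        using primorial_pos[of N] by (auto dest: dvd_imp_le dvd_pos_nat simp: Suc_le_eq simp del: prod_pos_nat_iff)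
    qed (auto simp: f_def)
    also have "\<dots> \<le> 1 + 1 / e" unfolding f_def by (rule sum_inverse_powr_le[OF e])
    finally show ?thesis by (simp add: e_def)
  qed
  have sq: "(\<Sum>p\<in>?P. 1 / real p ^ 2) \<le> 2"
    by (rule sum_inverse_squares_le) (auto dest: primes_uptoD)
  \<comment> \<open>Replacing 1/p by \<open>f p\<close> costs \<open>e\<close> times ln p / p,
    because exp(-u) >= 1 - u; replacing \<open>f p\<close> by \<open>ln (1 + f p)\<close> costs its
    square, at most 1/p^2. After summation either loss is at most 2.\<close>
  have bd: "1 / real p \<le> ln (1 + f p) + 1 / real p ^ 2 + e * (ln (real p) / real p)"
    if "p \<in> ?P" for p
  proof -
    have p: "p \<ge> 2" using primes_uptoD[OF that] by simp
    have fe: "f p = exp (- (e * ln (real p))) / real p"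
    proof -
      have "f p = exp (- (e * ln (real p)) - ln (real p))"
        using p by (simp add: f_def powr_def algebra_simps)
      also have "\<dots> = exp (- (e * ln (real p))) / real p" using p by (simp only: exp_diff) simp
      finally show ?thesis .
    qed
    have "exp (- (e * ln (real p))) \<ge> 1 - e * ln (real p)"
      using exp_ge_add_one_self[of "- (e * ln (real p))"] by simp
    then have "f p \<ge> (1 - e * ln (real p)) / real p"
      unfolding fe using p by (intro divide_right_mono) auto
    then have 1: "1 / real p \<le> f p + e * (ln (real p) / real p)"
      by (simp add: diff_divide_distrib)
    have f1: "f p \<le> 1 / real p"
      unfolding fe using p e by (intro divide_right_mono) auto
    also have "\<dots> \<le> 1" using p by simp
    finally have "f p \<le> 1" .
    then have "f p - (f p)\<^sup>2 \<le> ln (1 + f p)"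
      using fpos[OF that] by (intro ln_one_plus_pos_lower_bound) auto
    moreover have "(f p)\<^sup>2 \<le> (1 / real p)\<^sup>2" using f1 fpos[OF that] by (intro power_mono) auto
    ultimately show ?thesis using 1 by (simp add: power_divide)
  qed
  have "(\<Sum>p\<in>?P. 1 / real p)
      \<le> (\<Sum>p\<in>?P. ln (1 + f p)) + (\<Sum>p\<in>?P. 1 / real p ^ 2) + e * (\<Sum>p\<in>?P. ln (real p) / real p)"
    unfolding sum_distrib_left sum.distrib[symmetric] by (intro sum_mono bd)
  also have "(\<Sum>p\<in>?P. ln (1 + f p)) = ln (\<Prod>p\<in>?P. 1 + f p)"
    by (subst ln_prod) (auto dest: fpos)
  also have "\<dots> \<le> ln (1 + L)"
    using euler L by (intro ln_mono) (auto intro!: prod_pos add_pos_pos fpos)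
  \<comment> \<open>Valid because \<open>L \<ge> 1 / 2\<close>. The constant 7 of the statement
    covers 2 for \<open>ln 3\<close>, 2 for the squares and 2 for the term with
    \<open>e\<close>.\<close>
  also have "\<dots> \<le> ln (3 * L)" using L by (intro ln_mono) auto
  also have "\<dots> = ln 3 + ln L" using L by (simp add: ln_mult)
  also have "ln 3 \<le> (3::real) - 1" by (rule ln_le_minus_one) simp
  also have "e * (\<Sum>p\<in>?P. ln (real p) / real p) \<le> e * (2 * L)"
    unfolding L_def using assms e by (intro mult_left_mono sum_ln_primes_div_le) auto
  also have "e * (2 * L) = 2" using L by (simp add: e_def)
  finally show ?thesis using sq by (simp add: L_def)
qed

text \<open>For p >= 2 one has p/(p-1) <= 1 + 1/p + 2/p^2, and the sum of 1/p^2 is at most 2; this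
  is the 4.\<close>

lemma prod_prime_ratio_le_exp:
  fixes A :: "nat set"
  assumes "finite A" "\<And>p. p \<in> A \<Longrightarrow> prime p"
  shows "(\<Prod>p\<in>A. real p / real (p - 1)) \<le> exp ((\<Sum>p\<in>A. 1 / real p) + 4)"
proof -
  have t: "real p / real (p - 1) \<le> exp (1 / real p + 2 / real p ^ 2)" if "p \<in> A" for p
  proof -
    have p: "p \<ge> 2" using assms(2)[OF that] by (rule prime_ge_2_nat)
    have "real p / real (p - 1) \<le> 1 + (1 / real p + 2 / real p ^ 2)"
      using p by (simp add: of_nat_diff divide_simps power2_eq_square) (simp add: algebra_simps)
    also have "\<dots> \<le> exp (1 / real p + 2 / real p ^ 2)" by (rule exp_ge_add_one_self)
    finally show ?thesis .
  qed
  have "(\<Prod>p\<in>A. real p / real (p - 1)) \<le> (\<Prod>p\<in>A. exp (1 / real p + 2 / real p ^ 2))"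
    by (intro prod_mono conjI t) auto
  also have "\<dots> = exp ((\<Sum>p\<in>A. 1 / real p) + 2 * (\<Sum>p\<in>A. 1 / real p ^ 2))"
    using assms(1) by (simp add: sum.distrib sum_distrib_left flip: exp_sum)
  also have "(\<Sum>p\<in>A. 1 / real p ^ 2) \<le> 2"
    using assms by (intro sum_inverse_squares_le) (auto intro: prime_gt_0_nat)
  finally show ?thesis by simp
qed

lemma ratio_totient_eq_prod:
  assumes "n > 0"
  shows "real n / real (totient n) = (\<Prod>p\<in>prime_factors n. real p / real (p - 1))"
proof -
  have "real (totient n) = real n * (\<Prod>p\<in>prime_factors n. 1 - 1 / real p)"
    by (rule totient_formula2)
  also have "(\<Prod>p\<in>prime_factors n. 1 - 1 / real p) = (\<Prod>p\<in>prime_factors n. inverse (real p / real (p - 1)))"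
  proof (rule prod.cong[OF refl])
    fix p assume "p \<in> prime_factors n"
    then have "p \<ge> 2" by (auto intro: prime_ge_2_nat)
    then show "1 - 1 / real p = inverse (real p / real (p - 1))"
      by (simp add: field_simps of_nat_diff)
  qed
  also have "\<dots> = inverse (\<Prod>p\<in>prime_factors n. real p / real (p - 1))"
    using prod_inversef[of "\<lambda>p. real p / real (p - 1)" "prime_factors n"] unfolding comp_def .
  finally show ?thesis using assms by (simp add: field_simps)
qed

text \<open>There are at most $2 \log h$ prime factors of $n$ beyond $\log h$, so they contribute $O(1)$
  to $\sum_{p \mid n} 1/p$.\<close>

lemma ratio_totient_le:
  assumes "n \<ge> 1" "n \<le> h" "h \<ge> 2"
  shows "real n / real (totient n) \<le> exp 13 * ln (ln (real h) + 3)"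
proof -
  let ?L = "ln (real h)"
  have L: "?L \<ge> 1 / 2" using assms by (intro ln_nat_ge_half)
  \<comment> \<open>A threshold just above \<open>?L\<close>: prime factors beyond it contribute at
    most \<open>1 / ?L\<close> each, and \<open>N \<ge> 2\<close> keeps
    \<open>ln (ln (real N))\<close> meaningful. The final 13 is 7 (primes up to \<open>N\<close>) +
    2 (larger primes) + 4 (from the product bound).\<close>
  define N where "N = nat \<lceil>?L\<rceil> + 1"
  have N: "N \<ge> 2" "real N \<ge> ?L" "real N \<le> ?L + 2" unfolding N_def using L by linarith+
  let ?A = "prime_factors n"
  have card: "real (card ?A) \<le> 2 * ?L"
  proof -
    have "(2::nat) ^ card ?A \<le> (\<Prod>p\<in>?A. p ^ multiplicity p n)"
    proof -
      have "(2::nat) ^ card ?A = (\<Prod>p\<in>?A. 2)" by simp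
      also have "\<dots> \<le> (\<Prod>p\<in>?A. p ^ multiplicity p n)"
      proof (intro prod_mono conjI)
        fix p assume p: "p \<in> ?A"
        then have "p \<ge> 2" "multiplicity p n > 0"
          by (auto simp: prime_factors_multiplicity intro: prime_ge_2_nat)
        then show "2 \<le> p ^ multiplicity p n"
          using self_le_power[of p "multiplicity p n"] by linarith
      qed auto
      finally show ?thesis .
    qed
    also have "\<dots> = n" using assms by (simp add: prod_prime_factors)
    finally have "real (2 ^ card ?A) \<le> real h" using assms by linarith
    then have "ln (real (2 ^ card ?A)) \<le> ?L" by (intro ln_mono) auto
    then have "real (card ?A) * ln 2 \<le> ?L" by (simp add: ln_realpow)
    moreover have "real (card ?A) * (1 / 2) \<le> real (card ?A) * ln 2"
      using ln_nat_ge_half[of 2] by (intro mult_left_mono) auto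
    ultimately show ?thesis by simp
  qed
  have "(\<Sum>p\<in>?A. 1 / real p) = (\<Sum>p\<in>?A \<inter> {..N}. 1 / real p) + (\<Sum>p\<in>?A - {..N}. 1 / real p)"
    by (intro sum.Int_Diff) auto
  also have "(\<Sum>p\<in>?A \<inter> {..N}. 1 / real p) \<le> (\<Sum>p\<in>primes_upto N. 1 / real p)"
    by (intro sum_mono2) (auto simp: primes_upto_def)
  also have "\<dots> \<le> ln (ln (real N)) + 7" using N by (intro sum_inverse_primes_le) auto
  also have "(\<Sum>p\<in>?A - {..N}. 1 / real p) \<le> (\<Sum>p\<in>?A - {..N}. 1 / ?L)"
    using L N by (intro sum_mono divide_left_mono) auto
  also have "\<dots> \<le> real (card ?A) / ?L"
    using L by (auto intro!: divide_right_mono card_mono)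
  also have "\<dots> \<le> 2" using card L by (simp add: divide_simps)
  finally have s: "(\<Sum>p\<in>?A. 1 / real p) \<le> ln (ln (real N)) + 9" by simp
  have lnN: "ln (real N) > 0" using N by simp
  have "real n / real (totient n) \<le> exp ((\<Sum>p\<in>?A. 1 / real p) + 4)"
    using assms ratio_totient_eq_prod[of n] prod_prime_ratio_le_exp[of ?A] by auto
  also have "\<dots> \<le> exp (13 + ln (ln (real N)))" using s by simp
  also have "\<dots> = exp 13 * ln (real N)" using lnN by (simp add: exp_add)
  also have "\<dots> \<le> exp 13 * ln (?L + 3)"
    using N L by (intro mult_left_mono ln_mono) auto
  finally show ?thesis .
qed

text \<open>The summand is the weight that the parameter g acquires, and it also majorizes those of
  x, y, z. At a prime it equals (1+t)^3 / p with t = 1/(p-1), that is 1/p + O(1/p^2), so the Euler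
  product is comparable to exp of the sum of 1/p. The exponent is 39 = 7 + 16 * 2.\<close>

lemma sum_divisors_primorial_le:
  assumes "N \<ge> 2"
  shows "(\<Sum>d | d dvd \<Prod>(primes_upto N). real d ^ 2 / real (totient d) ^ 3) \<le> exp 39 * ln (real N)"
proof -
  let ?f = "\<lambda>d. real d ^ 2 / real (totient d) ^ 3"
  let ?P = "primes_upto N"
  have "(\<Sum>d | d dvd \<Prod>?P. ?f d) = (\<Prod>p\<in>?P. 1 + ?f p)"
    by (rule sum_divisors_prod_primes)
      (auto simp: totient_mult_coprime power_mult_distrib dest: primes_uptoD)
  also have "\<dots> \<le> (\<Prod>p\<in>?P. exp (1 / real p + 16 / real p ^ 2))"
  proof (intro prod_mono conjI)
    fix p assume "p \<in> ?P"
    then have p: "prime p" "p \<ge> 2" by (auto dest: primes_uptoD)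
    define t where "t = 1 / (real p - 1)"
    have t: "0 \<le> t" "t \<le> 1" using p by (auto simp: t_def)
    have r: "real p = (1 + t) * (real p - 1)" using p by (simp add: t_def field_simps)
    have tp: "t \<le> 2 / real p" using p by (simp add: t_def field_simps)
    have "?f p = real p ^ 2 / (real p - 1) ^ 3" using p by (simp add: totient_prime of_nat_diff)
    also have "\<dots> = (1 + t) ^ 3 / real p"
    proof -
      have "(real p) ^ 3 = (1 + t) ^ 3 * (real p - 1) ^ 3"
        using r by (metis power_mult_distrib)
      moreover have "real p ^ 3 = real p * real p ^ 2" by (simp add: power3_eq_cube power2_eq_square)
      moreover have "(real p - 1) ^ 3 > 0" using p by simp
      ultimately show ?thesis using p by (simp add: frac_eq_eq mult.commute)
    qed
    also have "(1 + t) ^ 3 \<le> 1 + 7 * t"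
    proof -
      have "t * t \<le> t" "t * (t * t) \<le> t" using t by (simp_all add: mult_left_le mult_le_one)
      then show ?thesis by (simp add: power3_eq_cube algebra_simps)
    qed
    also have "1 + 7 * t \<le> 1 + 16 / real p"
    proof -
      have "7 * (2 / real p) \<le> 16 / real p" using p by (simp add: divide_right_mono)
      then show ?thesis using tp by linarith
    qed
    finally have "1 + ?f p \<le> 1 + (1 / real p + 16 / real p ^ 2)"
      using p by (simp add: divide_right_mono add_divide_distrib power2_eq_square)
    also have "\<dots> \<le> exp (1 / real p + 16 / real p ^ 2)" by (rule exp_ge_add_one_self)
    finally show "1 + ?f p \<le> exp (1 / real p + 16 / real p ^ 2)" .
  qed (auto intro: add_nonneg_nonneg)
  also have "\<dots> = exp ((\<Sum>p\<in>?P. 1 / real p) + 16 * (\<Sum>p\<in>?P. 1 / real p ^ 2))"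
    by (simp add: sum.distrib sum_distrib_left flip: exp_sum)
  also have "(\<Sum>p\<in>?P. 1 / real p ^ 2) \<le> 2"
    by (rule sum_inverse_squares_le) (auto dest: primes_uptoD)
  also have "(\<Sum>p\<in>?P. 1 / real p) \<le> ln (ln (real N)) + 7" by (rule sum_inverse_primes_le[OF assms])
  also have "exp (ln (ln (real N)) + 7 + 16 * 2) = exp 39 * ln (real N)"
    using ln_nat_ge_half[OF assms] by (simp add: exp_add add.commute)
  finally show ?thesis by simp
qed

section \<open>Truncated reciprocals and exponential sums\<close>

text \<open>The power u^(3/2), written with \<open>sqrt\<close> to stay clear of real
  exponents.\<close>

definition psi :: "real \<Rightarrow> real" where "psi u = u * sqrt u"

lemma psi_nonneg [simp]: "u \<ge> 0 \<Longrightarrow> psi u \<ge> 0"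
  by (simp add: psi_def)

lemma psi_mono: "0 \<le> u \<Longrightarrow> u \<le> v \<Longrightarrow> psi u \<le> psi v"
  unfolding psi_def by (intro mult_mono) auto

text \<open>The right-hand side is the integral of w^(-3/2) over [u, v], the left-hand side the
  rectangle of height v^(-3/2) below it. With s = sqrt u and t = sqrt v it reduces to s (t + s) <= 2
  t^2.\<close>

lemma inverse_psi_le_diff:
  assumes "0 < u" "u < v"
  shows "(v - u) * psi (1 / v) \<le> 2 * (sqrt (1 / u) - sqrt (1 / v))"
proof -
  define s t where "s = sqrt u" and "t = sqrt v"
  have st: "0 < s" "s < t" using assms by (auto simp: s_def t_def)
  have uv: "u = s * s" "v = t * t" using assms by (auto simp: s_def t_def)
  have "s * (t + s) \<le> t * (t + t)"
    using st by (intro mult_mono add_mono) auto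
  then have "(t - s) * (s * (t + s)) \<le> (t - s) * (t * (t + t))"
    using st by (intro mult_left_mono) auto
  then have "s * (t * (t * 3)) \<le> s * (s * s) + t * (t * (t * 2))"
    by (simp add: algebra_simps)
  then have "(t * t - s * s) / (t * t * t) \<le> 2 * (1 / s - 1 / t)"
    using st by (simp add: divide_simps) (simp add: algebra_simps)
  moreover have "sqrt (1 / u) = 1 / s" "sqrt (1 / v) = 1 / t" "psi (1 / v) = 1 / (t * t * t)"
    using st by (auto simp: uv psi_def real_sqrt_divide)
  ultimately show ?thesis by (simp add: uv)
qed

text \<open>The minimum is at most twice the harmonic expression 1 / (1/h + b/Q) =
  \<open>1 / c b\<close>, and \<open>c\<close> grows in steps of 1/Q, so
  \<open>inverse_psi_le_diff\<close> telescopes to sqrt(1 / c 0) = sqrt h. The 6 is 2 times 3, where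
  3 exceeds psi(2) = 2 sqrt 2.\<close>

lemma sum_psi_min_le:
  fixes Q h :: real
  assumes Q: "Q > 0" and h: "h > 0"
  shows "(\<Sum>b=1..N. psi (min h (Q / real b))) \<le> 6 * Q * sqrt h"
proof -
  define c where "c = (\<lambda>n::nat. 1 / h + real n / Q)"
  have c: "c n > 0" for n using Q h by (auto simp: c_def intro!: add_pos_nonneg)
  have cs: "c (Suc n) = c n + 1 / Q" for n by (simp add: c_def field_simps add_divide_distrib)
  have bd: "psi (min h (Q / real (Suc n))) \<le> 6 * Q * (sqrt (1 / c n) - sqrt (1 / c (Suc n)))" for n
  proof -
    let ?b = "Suc n" and ?m = "min h (Q / real (Suc n))"
    have m: "?m > 0" using Q h by simp
    have "?m * real ?b \<le> Q / real ?b * real ?b" by (intro mult_right_mono) auto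
    then have "?m * real ?b \<le> Q" by simp
    then have "real ?b / Q \<le> 1 / ?m" using Q m by (simp add: divide_simps mult.commute del: of_nat_Suc)
    moreover have "1 / h \<le> 1 / ?m" using h m by (intro divide_left_mono) auto
    ultimately have "c ?b \<le> 2 / ?m" by (simp add: c_def)
    then have "?m \<le> 2 * (1 / c ?b)" using m c[of ?b] by (simp add: field_simps)
    then have "psi ?m \<le> psi (2 * (1 / c ?b))" using m by (intro psi_mono) auto
    also have "\<dots> = 2 * sqrt 2 * psi (1 / c ?b)" by (simp add: psi_def real_sqrt_divide)
    also have "\<dots> \<le> 3 * psi (1 / c ?b)"
    proof (rule mult_right_mono)
      have "sqrt 2 \<le> 3 / 2" by (rule real_le_lsqrt) (auto simp: power2_eq_square)
      then show "2 * sqrt 2 \<le> (3::real)" by simp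
    qed (use c[of ?b] in simp)
    finally have 1: "psi ?m \<le> 3 * psi (1 / c ?b)" .
    have "(c ?b - c n) * psi (1 / c ?b) \<le> 2 * (sqrt (1 / c n) - sqrt (1 / c ?b))"
      using Q c by (intro inverse_psi_le_diff) (auto simp: cs)
    then have "psi (1 / c ?b) \<le> 2 * Q * (sqrt (1 / c n) - sqrt (1 / c ?b))"
      using Q by (simp add: cs divide_le_eq mult_ac)
    then show ?thesis using 1 by (simp add: mult.assoc)
  qed
  have "(\<Sum>b=1..N. psi (min h (Q / real b))) \<le> 6 * Q * (sqrt (1 / c 0) - sqrt (1 / c N))"
  proof (induction N)
    case (Suc N)
    then show ?case using bd[of N] by (simp add: algebra_simps)
  qed simp
  also have "\<dots> \<le> 6 * Q * sqrt h" using Q c[of N] by (simp add: c_def)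
  finally show ?thesis .
qed

text \<open>In a residue class modulo \<open>y\<close> the quotient j = b div y determines b, and y
  K / b <= K / j; so the full sum with \<open>Q = K\<close> is a bound. Only j = 0 escapes and is
  charged the maximal value \<open>psi h\<close>.\<close>

lemma sum_psi_min_residue_class_le:
  fixes K h :: real and y :: nat
  assumes K: "K > 0" and h: "h > 0" and y: "y > 0" and fin: "finite B"
    and cong: "\<And>b b'. b \<in> B \<Longrightarrow> b' \<in> B \<Longrightarrow> b mod y = b' mod y"
  shows "(\<Sum>b\<in>B. psi (min h (real y * K / real b))) \<le> psi h + 6 * K * sqrt h"
proof -
  \<comment> \<open>Division by zero would make the value at \<open>j = 0\<close> vanish, so it is
    set by hand.\<close>
  define g where "g = (\<lambda>j::nat. if j = 0 then psi h else psi (min h (K / real j)))"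
  have "inj_on (\<lambda>b. b div y) B"
  proof (rule inj_onI)
    fix b b' assume "b \<in> B" "b' \<in> B" "b div y = b' div y"
    then show "b = b'" using cong[of b b'] by (metis div_mult_mod_eq)
  qed
  then have re: "(\<Sum>b\<in>B. g (b div y)) = (\<Sum>j\<in>(\<lambda>b. b div y) ` B. g j)"
    by (simp add: sum.reindex)
  define N where "N = Max (insert 1 ((\<lambda>b. b div y) ` B))"
  have "psi (min h (real y * K / real b)) \<le> g (b div y)" for b
  proof (cases "b div y = 0")
    case True
    have "0 \<le> real y * K / real b" using K by simp
    then show ?thesis using True h by (auto simp: g_def intro!: psi_mono)
  next
    case False
    have "b > 0" using False by (metis div_0 gr0I)
    have "real y * real (b div y) \<le> real b"
      by (metis of_nat_le_iff of_nat_mult times_div_less_eq_dividend)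
    then have "real y * K / real b \<le> real y * K / (real y * real (b div y))"
      using K y False \<open>b > 0\<close> by (intro divide_left_mono) (auto intro!: mult_pos_pos)
    also have "\<dots> = K / real (b div y)" using y by simp
    finally have "min h (real y * K / real b) \<le> min h (K / real (b div y))" by linarith
    moreover have "0 \<le> min h (real y * K / real b)" using h K by simp
    ultimately show ?thesis unfolding g_def using False by (auto intro!: psi_mono)
  qed
  then have "(\<Sum>b\<in>B. psi (min h (real y * K / real b))) \<le> (\<Sum>b\<in>B. g (b div y))"
    by (intro sum_mono)
  also have "\<dots> \<le> (\<Sum>j\<in>{0..N}. g j)" unfolding re
  proof (rule sum_mono2)
    show "(\<lambda>b. b div y) ` B \<subseteq> {0..N}"
      unfolding N_def using fin by (auto intro!: Max_ge)
  qed (use h K in \<open>auto simp: g_def\<close>)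
  also have "\<dots> = psi h + (\<Sum>j=1..N. psi (min h (K / real j)))"
    by (subst sum.atLeast_Suc_atMost) (auto simp: g_def intro!: sum.cong)
  also have "\<dots> \<le> psi h + 6 * K * sqrt h" using sum_psi_min_le[OF K h, of N] by simp
  finally show ?thesis .
qed

text \<open>The larger \<open>b\<close> of \<open>n1\<close>, \<open>n2\<close> satisfies
  \<open>n3 \<le> 2 * b\<close>, so \<open>F b\<close> is at most \<open>F a\<close>
  (\<open>a\<close> being the smaller one) and at most \<open>2 * F n3\<close>, hence at most twice
  their geometric mean. Substituting this for \<open>F b\<close> leaves two factors with exponent
  3/2. Index 3 stays in both pairs, which later keeps gcd(q1, q2) in the same position.\<close>

lemma prod_le_psi_pairs:
  fixes h n1 n2 n3 :: real
  assumes "h > 0" "n1 > 0" "n2 > 0" "n3 > 0" "n3 \<le> n1 + n2"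
  defines "F \<equiv> \<lambda>n. min h (1 / n)"
  shows "F n1 * F n2 * F n3 \<le> 2 * (psi (F n1) * psi (F n3) + psi (F n2) * psi (F n3))"
proof -
  have main: "F a * F b * F n3 \<le> 2 * (psi (F a) * psi (F n3))"
    if "0 < a" "a \<le> b" "n3 \<le> 2 * b" for a b
  proof -
    have pos: "F a > 0" "F b > 0" "F n3 > 0" using that assms by (auto simp: F_def)
    have "1 / b \<le> 1 / a" using that by (intro divide_left_mono) auto
    then have ba: "F b \<le> F a" unfolding F_def by linarith
    have "1 / (2 * b) \<le> 1 / n3" using that assms by (intro divide_left_mono) auto
    moreover have "1 / (2 * b) = (1 / b) / 2" by simp
    ultimately have b3: "F b \<le> 2 * F n3"
      using \<open>h > 0\<close> unfolding F_def by (auto simp: min_def)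
    have "(F b)\<^sup>2 \<le> F a * (2 * F n3)" unfolding power2_eq_square
      using ba b3 pos by (intro mult_mono) auto
    also have "\<dots> \<le> 4 * (F a * F n3)" using pos by simp
    finally have "sqrt ((F b)\<^sup>2) \<le> sqrt (2\<^sup>2 * (F a * F n3))" by (intro real_sqrt_le_mono) simp
    then have "F b \<le> 2 * (sqrt (F a) * sqrt (F n3))"
      using pos by (simp add: real_sqrt_mult)
    then have "(F a * F n3) * F b \<le> (F a * F n3) * (2 * (sqrt (F a) * sqrt (F n3)))"
      using pos by (intro mult_left_mono) auto
    then show ?thesis by (simp add: psi_def algebra_simps)
  qed
  have nn: "psi (F n1) * psi (F n3) \<ge> 0" "psi (F n2) * psi (F n3) \<ge> 0"
    using assms by (auto simp: F_def)
  show ?thesis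
  proof (cases "n1 \<le> n2")
    case True
    have "F n1 * F n2 * F n3 \<le> 2 * (psi (F n1) * psi (F n3))"
      using True assms(2-5) by (intro main) auto
    then show ?thesis by (rule order_trans) (use nn in simp)
  next
    case False
    have "F n1 * F n2 * F n3 \<le> 2 * (psi (F n2) * psi (F n3))"
      using False assms(2-5) main[of n2 n1] by (simp add: mult.commute)
    then show ?thesis by (rule order_trans) (use nn in simp)
  qed
qed

text \<open>A geometric sum: the numerator has norm at most 2 and |1 - w| = 2 sin(pi t), which
  dominates twice the distance of t to the nearest integer.\<close>

lemma norm_sum_unit_exp_le_inverse:
  fixes t :: real
  assumes t: "0 < t" "t < 1"
  shows "norm (\<Sum>d\<in>{1..int h}. unit_exp (t * of_int d)) \<le> 1 / min t (1 - t)"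
proof -
  define w where "w = unit_exp t"
  have pw: "unit_exp (t * of_int (int n)) = w ^ n" for n
    by (simp add: unit_exp_def w_def exp_of_nat_mult[symmetric] mult_ac)
  have "{1..int h} = int ` {1..h}" by (simp add: image_int_atLeastAtMost)
  then have "(\<Sum>d\<in>{1..int h}. unit_exp (t * of_int d)) = (\<Sum>n=1..h. unit_exp (t * of_int (int n)))"
    by (simp only:) (subst sum.reindex, auto)
  then have s: "(\<Sum>d\<in>{1..int h}. unit_exp (t * of_int d)) = (\<Sum>n=1..h. w ^ n)"
    by (simp only: pw)
  have nw: "norm w = 1" by (simp add: w_def unit_exp_def)
  have tel: "(1 - w) * (\<Sum>n=1..h. w ^ n) = w - w ^ Suc h"
  proof (induction h)
    case (Suc h)
    have "(1 - w) * (\<Sum>n=1..Suc h. w ^ n) = (1 - w) * (\<Sum>n=1..h. w ^ n) + (1 - w) * w ^ Suc h"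
      by (simp add: algebra_simps)
    also have "\<dots> = w - w ^ Suc (Suc h)" unfolding Suc.IH by (simp add: algebra_simps)
    finally show ?case .
  qed simp
  have w1: "norm (1 - w) = 2 * sin (pi * t)"
  proof -
    have "Re w = cos (2 * (pi * t))" "Im w = sin (2 * (pi * t))"
      by (simp_all add: w_def unit_exp_def Re_exp Im_exp mult_ac)
    then have "(norm (1 - w))\<^sup>2 = (1 - cos (2 * (pi * t)))\<^sup>2 + (sin (2 * (pi * t)))\<^sup>2"
      by (simp add: cmod_power2)
    also have "\<dots> = (2 * sin (pi * t))\<^sup>2"
    proof -
      have "(1 - cos (2 * (pi * t)))\<^sup>2 + (sin (2 * (pi * t)))\<^sup>2 = 2 - 2 * cos (2 * (pi * t))"
        using sin_cos_squared_add[of "2 * (pi * t)"] by (simp add: power2_eq_square algebra_simps)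
      moreover have "cos (2 * (pi * t)) = 1 - 2 * (sin (pi * t))\<^sup>2" by (rule cos_double_sin)
      ultimately have "(1 - cos (2 * (pi * t)))\<^sup>2 + (sin (2 * (pi * t)))\<^sup>2 = 4 * (sin (pi * t))\<^sup>2"
        by linarith
      then show ?thesis by (simp only: power_mult_distrib) simp
    qed
    finally show ?thesis
      by (rule power2_eq_imp_eq) (use t in \<open>auto intro!: sin_ge_zero\<close>)
  qed
  \<comment> \<open>With x = pi s in [0, 2], Taylor gives sin x >= x - x^3/6 >= x/3, and x >= 3 s
    because pi >= 3. The latter is 1/2 = sin(pi/6) <= pi/6.\<close>
  have sin_half: "s \<le> sin (pi * s)" if "0 \<le> s" "s \<le> 1 / 2" for s :: real
  proof -
    define x where "x = pi * s"
    have "pi / 6 \<ge> 1 / 2" using sin_x_le_x[of "pi / 6"] by (simp add: sin_30)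
    then have "3 * s \<le> x" unfolding x_def using that by (intro mult_right_mono) auto
    have "pi * s \<le> pi * (1 / 2)" using that by (intro mult_left_mono) auto
    then have "x \<le> 2" unfolding x_def using pi_half_less_two by linarith
    moreover have "0 \<le> x" unfolding x_def using that by simp
    ultimately have x: "0 \<le> x" "x \<le> 2" by auto
    have "\<bar>sin x - (\<Sum>m<3. sin_coeff m * x ^ m)\<bar> \<le> inverse (fact 3) * \<bar>x\<bar> ^ 3"
      by (rule Maclaurin_sin_bound)
    then have "\<bar>sin x - x\<bar> \<le> x ^ 3 / 6"
      using x by (simp add: eval_nat_numeral sin_coeff_def)
    moreover have "x * x\<^sup>2 \<le> x * 2\<^sup>2" using x by (intro mult_left_mono power_mono) auto
    then have "x ^ 3 \<le> x * 4" by (simp add: power3_eq_cube power2_eq_square)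
    ultimately have "x / 3 \<le> sin x" by linarith
    then show ?thesis using \<open>3 * s \<le> x\<close> by (simp add: x_def)
  qed
  have "sin (pi * t) \<ge> min t (1 - t)"
  proof (cases "t \<le> 1 / 2")
    case True
    then show ?thesis using sin_half[of t] t by simp
  next
    case False
    have "sin (pi * t) = sin (pi * (1 - t))" by (simp add: algebra_simps)
    then show ?thesis using sin_half[of "1 - t"] t False by simp
  qed
  then have "2 * min t (1 - t) * norm (\<Sum>n=1..h. w ^ n) \<le> norm (1 - w) * norm (\<Sum>n=1..h. w ^ n)"
    unfolding w1 by (intro mult_right_mono) auto
  also have "\<dots> = norm (w - w ^ Suc h)" unfolding norm_mult[symmetric] tel ..
  also have "\<dots> \<le> norm w + norm (w ^ Suc h)" by (rule norm_triangle_ineq4)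
  also have "\<dots> = 2" using nw by (simp add: norm_power norm_mult)
  finally show ?thesis unfolding s using t by (simp add: field_simps)
qed

section \<open>Congruence conditions\<close>

text \<open>The function F(a/q) of the overview for 0 < a < q, where the distance to the nearest
  integer is min(a, q - a)/q. At a = 0 or a >= q division by zero gives 0, so the estimates require
  0 < a < q.\<close>

definition expsum_bound :: "nat \<Rightarrow> nat \<Rightarrow> nat \<Rightarrow> real" where
  "expsum_bound h q a = min (real h) (real q / real (min a (q - a)))"

lemma expsum_bound_nonneg [simp]: "expsum_bound h q a \<ge> 0"
  by (simp add: expsum_bound_def)

lemma norm_sum_unit_exp_le_expsum_bound:
  assumes "0 < a" "a < q"
  shows "norm (\<Sum>d\<in>{1..int h}. unit_exp (real a * of_int d / real q)) \<le> expsum_bound h q a"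
proof -
  let ?t = "real a / real q"
  have q: "0 < ?t" "?t < 1" using assms by auto
  have "norm (\<Sum>d\<in>{1..int h}. unit_exp (?t * of_int d)) \<le> (\<Sum>d\<in>{1..int h}. 1)"
    by (rule sum_norm_le) (simp add: unit_exp_def)
  moreover have "1 / min ?t (1 - ?t) = real q / real (min a (q - a))"
  proof -
    have "min ?t (1 - ?t) = real (min a (q - a)) / real q"
      using assms by (auto simp: min_def field_simps of_nat_diff)
    then show ?thesis by simp
  qed
  ultimately show ?thesis
    using norm_sum_unit_exp_le_inverse[OF q, of h] by (simp add: expsum_bound_def)
qed

text \<open>Whichever of a and q - a is smaller, its term is on the right and the other is
  nonnegative. The enlarged \<open>Q\<close> serves dyadic blocks, where the modulus varies with z
  but the bound must not.\<close>

lemma psi_expsum_bound_le: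
  assumes "0 < a" "a < q" "q \<le> Q"
  shows "psi (expsum_bound h q a) \<le> psi (min (real h) (real Q / real a)) + psi (min (real h) (real Q / real (q - a)))"
proof -
  have le: "psi (min (real h) (real q / real b)) \<le> psi (min (real h) (real Q / real b))" for b
  proof (rule psi_mono)
    have "real q / real b \<le> real Q / real b" using assms by (intro divide_right_mono) auto
    then show "min (real h) (real q / real b) \<le> min (real h) (real Q / real b)" by linarith
  qed simp
  show ?thesis
  proof (cases "a \<le> q - a")
    case True
    then show ?thesis using le[of a] by (simp add: expsum_bound_def min_def[of a] add_increasing2)
  next
    case False
    then show ?thesis using le[of "q - a"] by (simp add: expsum_bound_def min_def[of a] add_increasing)
  qed
qed

lemma sum_psi_expsum_bound_le:
  assumes "h > 0" "q > 0"
  shows "(\<Sum>a\<in>{0<..<q}. psi (expsum_bound h q a)) \<le> 12 * real q * sqrt (real h)"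
proof -
  let ?m = "\<lambda>b. psi (min (real h) (real q / real b))"
  have "(\<Sum>a\<in>{0<..<q}. psi (expsum_bound h q a)) \<le> (\<Sum>a\<in>{0<..<q}. ?m a + ?m (q - a))"
    by (intro sum_mono psi_expsum_bound_le) auto
  also have "\<dots> = (\<Sum>a\<in>{0<..<q}. ?m a) + (\<Sum>a\<in>{0<..<q}. ?m (q - a))" by (rule sum.distrib)
  also have "(\<Sum>a\<in>{0<..<q}. ?m (q - a)) = (\<Sum>a\<in>{0<..<q}. ?m a)"
    by (rule sum.reindex_bij_witness[of _ "\<lambda>a. q - a" "\<lambda>a. q - a"]) auto
  also have "(\<Sum>a\<in>{0<..<q}. ?m a) \<le> (\<Sum>a=1..q. ?m a)"
    by (rule sum_mono2) auto
  also have "\<dots> \<le> 6 * real q * sqrt (real h)" using assms by (intro sum_psi_min_le) auto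
  finally show ?thesis by simp
qed

lemma mod_eq_iff_int_dvd:
  fixes b b' y :: nat
  shows "b mod y = b' mod y \<longleftrightarrow> int y dvd int b - int b'"
  by (metis mod_eq_dvd_iff of_nat_eq_iff zmod_int)

lemma dvd_imp_mod_eq_nat:
  fixes b b' x y :: nat and c :: int
  assumes "int y dvd int b * int x + c" "int y dvd int b' * int x + c" "coprime x y"
  shows "b mod y = b' mod y"
proof -
  have "int y dvd (int b * int x + c) - (int b' * int x + c)" using assms by (intro dvd_diff)
  then have "int y dvd (int b - int b') * int x" by (simp add: algebra_simps)
  then have "int y dvd int b - int b'"
    using assms(3) by (metis coprime_commute coprime_dvd_mult_left_iff coprime_int_iff)
  then show ?thesis by (simp add: mod_eq_iff_int_dvd)
qed

text \<open>Here \<open>a\<close> stands for a_1 and \<open>c\<close> for a_3. For positive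
  parameters the divisibility says exactly that a_1/(gyz) + a_3/(gxy) = (a_1 x + a_3 z)/(gxyz) is a
  multiple of 1/(gxz), so that an a_2 exists; coprimality of the numerators is dropped.\<close>

definition admissible :: "nat \<Rightarrow> nat \<Rightarrow> nat \<Rightarrow> nat \<Rightarrow> nat \<Rightarrow> nat set" where
  "admissible g x y z c = {a \<in> {0<..<g * y * z}. y dvd a * x + c * z}"

lemma finite_admissible [simp]: "finite (admissible g x y z c)"
  by (simp add: admissible_def)

text \<open>Since x is invertible modulo y, the admissible a fill at most one residue class modulo
  y, and so do the q - a because y divides q = gyz. Each half gives \<open>psi h\<close> + 6 gz sqrt
  h, and h <= gz absorbs \<open>psi h\<close>; hence 14 = 2 * (1 + 6).\<close>

lemma sum_psi_expsum_bound_admissible_le: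
  assumes h: "h > 0" "h \<le> g * z" and y: "y > 0" and cop: "coprime x y"
  shows "(\<Sum>a\<in>admissible g x y z c. psi (expsum_bound h (g * y * z) a)) \<le> 14 * (real g * real z) * sqrt (real h)"
proof -
  let ?A = "admissible g x y z c" and ?q = "g * y * z"
  let ?m = "\<lambda>b. psi (min (real h) (real y * real (g * z) / real b))"
  have cong: "a mod y = a' mod y" if "a \<in> ?A" "a' \<in> ?A" for a a'
  proof (rule dvd_imp_mod_eq_nat[where c = "int (c * z)"])
    show "int y dvd int a * int x + int (c * z)" "int y dvd int a' * int x + int (c * z)"
      using that by (simp_all add: admissible_def flip: of_nat_mult of_nat_add int_dvd_int_iff)
  qed fact
  have gz: "g * z > 0" using h by linarith
  have psih: "psi (real h) \<le> real (g * z) * sqrt (real h)"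
    unfolding psi_def using h by (intro mult_right_mono) (simp_all only: of_nat_le_iff real_sqrt_ge_zero of_nat_0_le_iff)
  have "(\<Sum>a\<in>?A. psi (expsum_bound h ?q a)) \<le> (\<Sum>a\<in>?A. ?m a + ?m (?q - a))"
  proof (rule sum_mono)
    fix a assume "a \<in> ?A"
    then have "0 < a" "a < ?q" by (auto simp: admissible_def)
    then have "psi (expsum_bound h ?q a) \<le> psi (min (real h) (real ?q / real a)) + psi (min (real h) (real ?q / real (?q - a)))"
      by (intro psi_expsum_bound_le) auto
    moreover have "real ?q = real y * real (g * z)" by simp
    ultimately show "psi (expsum_bound h ?q a) \<le> ?m a + ?m (?q - a)" by (simp only:)
  qed
  also have "\<dots> = (\<Sum>a\<in>?A. ?m a) + (\<Sum>a\<in>?A. ?m (?q - a))" by (rule sum.distrib)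
  also have "(\<Sum>a\<in>?A. ?m (?q - a)) = (\<Sum>b\<in>(\<lambda>a. ?q - a) ` ?A. ?m b)"
    by (subst sum.reindex) (auto simp: inj_on_def admissible_def)
  also have "\<dots> \<le> psi (real h) + 6 * real (g * z) * sqrt (real h)"
  proof (rule sum_psi_min_residue_class_le)
    fix b b' assume "b \<in> (\<lambda>a. ?q - a) ` ?A" "b' \<in> (\<lambda>a. ?q - a) ` ?A"
    then obtain a a' where a: "a \<in> ?A" "a' \<in> ?A" "b = ?q - a" "b' = ?q - a'" by auto
    have "int y dvd int a - int a'"
      using cong[OF a(1,2)] by (simp only: mod_eq_iff_int_dvd)
    moreover have "a < ?q" "a' < ?q" using a by (auto simp: admissible_def)
    then have "int b' - int b = int a - int a'"
      unfolding a by linarith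
    ultimately have "int y dvd int b' - int b" by simp
    then have "b' mod y = b mod y" by (simp only: mod_eq_iff_int_dvd)
    then show "b mod y = b' mod y" ..
  qed (use h y gz in simp_all)
  also have "(\<Sum>a\<in>?A. ?m a) \<le> psi (real h) + 6 * real (g * z) * sqrt (real h)"
    by (rule sum_psi_min_residue_class_le[OF _ _ y finite_admissible cong]) (use h gz in auto)
  finally show ?thesis using psih by simp
qed

lemma card_residue_class_le:
  fixes S :: "nat set"
  assumes "y > 0" "S \<subseteq> {..<R}" and cong: "\<And>b b'. b \<in> S \<Longrightarrow> b' \<in> S \<Longrightarrow> b mod y = b' mod y"
  shows "real (card S) \<le> real R / real y + 1"
proof -
  have "inj_on (\<lambda>b. b div y) S"
  proof (rule inj_onI)
    fix b b' assume "b \<in> S" "b' \<in> S" "b div y = b' div y"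
    then show "b = b'" using cong[of b b'] by (metis div_mult_mod_eq)
  qed
  moreover have "(\<lambda>b. b div y) ` S \<subseteq> {..R div y}" using assms by (auto intro!: div_le_mono)
  ultimately have "card S \<le> R div y + 1"
    using card_inj_on_le[of "\<lambda>b. b div y" S "{..R div y}"] by simp
  moreover have "real y * real (R div y) \<le> real R"
    by (metis of_nat_le_iff of_nat_mult times_div_less_eq_dividend)
  then have "real (R div y) \<le> real R / real y" using assms by (simp add: field_simps)
  ultimately show ?thesis by linarith
qed

text \<open>The sums are exchanged: for a fixed numerator b, invertibility of c modulo y puts z into
  one residue class, with at most R/y + 1 <= 2R/y members. The modulus gyz is first enlarged to gyR
  so that the summand no longer depends on z. Each half gives (2R/y) * 6 gyR sqrt h.\<close>

lemma sum_dyadic_block_le: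
  assumes h: "h > 0" and g: "g > 0" and y: "y > 0" and c: "coprime c y"
    and Z: "finite Z" "\<And>z. z \<in> Z \<Longrightarrow> y \<le> z \<and> z < R"
  shows "(\<Sum>z\<in>Z. \<Sum>a\<in>admissible g x y z c. psi (expsum_bound h (g * y * z) a))
    \<le> 24 * real g * real R ^ 2 * sqrt (real h)"
proof (cases "Z = {}")
  case True
  then show ?thesis by simp
next
  case False
  then have yR: "y \<le> R" using Z by fastforce
  have R: "R > 0" using yR y by linarith
  let ?Q = "g * y * R"
  let ?m = "\<lambda>b. psi (min (real h) (real ?Q / real b))"
  \<comment> \<open>The sign \<open>s\<close> is 1 for b = a and -1 for the reflected numerator b =
    q - a, as -b x = a x modulo y.\<close>
  let ?D = "\<lambda>s b z. int y dvd s * int b * int x + int c * int z"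
  have Qpos: "?Q > 0" using g y R by simp
  have half: "(\<Sum>z\<in>Z. \<Sum>b\<in>{b \<in> {1..?Q}. ?D s b z}. ?m b) \<le> 12 * real g * real R ^ 2 * sqrt (real h)"
    for s :: int
  proof -
    have "(\<Sum>z\<in>Z. \<Sum>b\<in>{b \<in> {1..?Q}. ?D s b z}. ?m b) = (\<Sum>b\<in>{1..?Q}. \<Sum>z\<in>{z \<in> Z. ?D s b z}. ?m b)"
      by (rule sum.swap_restrict) (use Z in auto)
    also have "\<dots> \<le> (\<Sum>b\<in>{1..?Q}. 2 * real R / real y * ?m b)"
    proof (rule sum_mono)
      fix b
      have "real (card {z \<in> Z. ?D s b z}) \<le> real R / real y + 1"
      proof (rule card_residue_class_le)
        fix z z' assume "z \<in> {z \<in> Z. ?D s b z}" "z' \<in> {z \<in> Z. ?D s b z}"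
        then show "z mod y = z' mod y"
          using c by (intro dvd_imp_mod_eq_nat[of y z c "s * int b * int x" z'])
            (auto simp: algebra_simps)
      qed (use y Z in auto)
      also have "1 \<le> real R / real y" using y yR by simp
      finally have "real (card {z \<in> Z. ?D s b z}) \<le> 2 * real R / real y" by simp
      then have "real (card {z \<in> Z. ?D s b z}) * ?m b \<le> 2 * real R / real y * ?m b"
        by (rule mult_right_mono) simp
      then show "(\<Sum>z\<in>{z \<in> Z. ?D s b z}. ?m b) \<le> 2 * real R / real y * ?m b" by simp
    qed
    also have "\<dots> = 2 * real R / real y * (\<Sum>b=1..?Q. ?m b)" by (simp add: sum_distrib_left)
    also have "\<dots> \<le> 2 * real R / real y * (6 * real ?Q * sqrt (real h))"
      by (intro mult_left_mono sum_psi_min_le) (use Qpos h in auto)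
    also have "\<dots> = 12 * real g * real R ^ 2 * sqrt (real h)"
      using y by (simp add: power2_eq_square)
    finally show ?thesis .
  qed
  have "(\<Sum>z\<in>Z. \<Sum>a\<in>admissible g x y z c. psi (expsum_bound h (g * y * z) a))
    \<le> (\<Sum>z\<in>Z. (\<Sum>b\<in>{b \<in> {1..?Q}. ?D 1 b z}. ?m b) + (\<Sum>b\<in>{b \<in> {1..?Q}. ?D (-1) b z}. ?m b))"
  proof (rule sum_mono)
    fix z assume z: "z \<in> Z"
    let ?A = "admissible g x y z c" and ?q = "g * y * z"
    have qQ: "?q \<le> ?Q" using Z(2)[OF z] by simp
    have "(\<Sum>a\<in>?A. psi (expsum_bound h ?q a)) \<le> (\<Sum>a\<in>?A. ?m a + ?m (?q - a))"
      by (intro sum_mono psi_expsum_bound_le qQ) (auto simp: admissible_def)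
    also have "\<dots> = (\<Sum>a\<in>?A. ?m a) + (\<Sum>a\<in>?A. ?m (?q - a))" by (rule sum.distrib)
    also have "(\<Sum>a\<in>?A. ?m (?q - a)) = (\<Sum>b\<in>(\<lambda>a. ?q - a) ` ?A. ?m b)"
      by (subst sum.reindex) (auto simp: inj_on_def admissible_def)
    also have "\<dots> \<le> (\<Sum>b\<in>{b \<in> {1..?Q}. ?D (-1) b z}. ?m b)"
    proof (rule sum_mono2)
      show "(\<lambda>a. ?q - a) ` ?A \<subseteq> {b \<in> {1..?Q}. ?D (-1) b z}"
      proof
        fix b assume "b \<in> (\<lambda>a. ?q - a) ` ?A"
        then obtain a where a: "0 < a" "a < ?q" "y dvd a * x + c * z" "b = ?q - a"
          by (auto simp: admissible_def)
        have "int y dvd int a * int x + int c * int z"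
          using a(3) by (metis int_dvd_int_iff of_nat_add of_nat_mult)
        then have "int y dvd (int a * int x + int c * int z) - int ?q * int x"
          by (intro dvd_diff) auto
        moreover have "int b = int ?q - int a" using a by (simp add: of_nat_diff)
        then have "(int a * int x + int c * int z) - int ?q * int x
            = - 1 * int b * int x + int c * int z"
          by (simp only:) (simp add: algebra_simps)
        ultimately have "?D (-1) b z" by (simp only:)
        moreover have "b \<in> {1..?Q}"
          using a(1,2,4) qQ unfolding atLeastAtMost_iff by linarith
        ultimately show "b \<in> {b \<in> {1..?Q}. ?D (-1) b z}" by blast
      qed
    qed auto
    also have "(\<Sum>a\<in>?A. ?m a) \<le> (\<Sum>b\<in>{b \<in> {1..?Q}. ?D 1 b z}. ?m b)"
    proof (rule sum_mono2)
      show "?A \<subseteq> {b \<in> {1..?Q}. ?D 1 b z}"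
      proof
        fix a assume "a \<in> ?A"
        then have a: "0 < a" "a < ?q" "y dvd a * x + c * z" by (auto simp: admissible_def)
        have "?D 1 a z"
          using a(3) by (metis int_dvd_int_iff of_nat_add of_nat_mult mult_1)
        moreover have "a \<in> {1..?Q}"
          using a(1,2) qQ unfolding atLeastAtMost_iff by linarith
        ultimately show "a \<in> {b \<in> {1..?Q}. ?D 1 b z}" by blast
      qed
    qed auto
    finally show "(\<Sum>a\<in>?A. psi (expsum_bound h ?q a))
      \<le> (\<Sum>b\<in>{b \<in> {1..?Q}. ?D 1 b z}. ?m b) + (\<Sum>b\<in>{b \<in> {1..?Q}. ?D (-1) b z}. ?m b)" by simp
  qed
  also have "\<dots> \<le> 12 * real g * real R ^ 2 * sqrt (real h) + 12 * real g * real R ^ 2 * sqrt (real h)"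
    unfolding sum.distrib by (intro add_mono half)
  finally show ?thesis by (simp add: mult_ac)
qed

text \<open>On the block 2^k <= z < 2^(k+1) the weight 1/phi(z)^2 is at most \<rho>^2 / 4^k, while
  the block sum is proportional to R^2 = 4 * 4^k. The powers of 4 cancel, so each of the
  \<open>K\<close> blocks costs the same, with 96 = 24 * 4.\<close>

lemma sum_admissible_dyadic_le:
  assumes h: "h > 0" and g: "g > 0" and y: "y > 0" and c: "coprime c y"
    and Z: "finite Z" "\<And>z. z \<in> Z \<Longrightarrow> y \<le> z \<and> z < 2 ^ K"
    and rho: "\<rho> > 0" "\<And>z. z \<in> Z \<Longrightarrow> real z / real (totient z) \<le> \<rho>"
  shows "(\<Sum>z\<in>Z. 1 / real (totient z) ^ 2 * (\<Sum>a\<in>admissible g x y z c. psi (expsum_bound h (g * y * z) a)))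
    \<le> 96 * real K * \<rho> ^ 2 * real g * sqrt (real h)"
proof -
  let ?S = "\<lambda>z. \<Sum>a\<in>admissible g x y z c. psi (expsum_bound h (g * y * z) a)"
  define B where "B = (\<lambda>k. {z \<in> Z. 2 ^ k \<le> z \<and> z < 2 ^ Suc k})"
  have S0: "?S z \<ge> 0" for z by (intro sum_nonneg) simp
  have block: "(\<Sum>z\<in>B k. 1 / real (totient z) ^ 2 * ?S z) \<le> 96 * \<rho> ^ 2 * real g * sqrt (real h)" for k
  proof -
    have "(\<Sum>z\<in>B k. 1 / real (totient z) ^ 2 * ?S z) \<le> (\<Sum>z\<in>B k. \<rho> ^ 2 / 4 ^ k * ?S z)"
    proof (intro sum_mono mult_right_mono S0)
      fix z assume z: "z \<in> B k"
      then have zZ: "z \<in> Z" and zk: "2 ^ k \<le> z" by (auto simp: B_def)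
      then have z0: "z > 0" using y Z(2)[OF zZ] by linarith
      have "(2::real) ^ k \<le> real z" using zk by (metis of_nat_le_iff of_nat_numeral of_nat_power)
      also have "real z \<le> \<rho> * real (totient z)" using rho(2)[OF zZ] z0 by (simp add: divide_le_eq)
      finally have "((2::real) ^ k) ^ 2 \<le> (\<rho> * real (totient z)) ^ 2" by (intro power_mono) auto
      moreover have "((2::real) ^ k) ^ 2 = 4 ^ k"
      proof -
        have "((2::real) ^ k) ^ 2 = (2 ^ 2) ^ k" by (simp only: power_mult[symmetric] mult.commute)
        then show ?thesis by simp
      qed
      ultimately have "4 ^ k \<le> \<rho> ^ 2 * real (totient z) ^ 2" by (simp add: power_mult_distrib)
      then show "1 / real (totient z) ^ 2 \<le> \<rho> ^ 2 / 4 ^ k"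
        using z0 by (simp add: divide_simps)
    qed
    also have "\<dots> = \<rho> ^ 2 / 4 ^ k * (\<Sum>z\<in>B k. ?S z)" by (simp add: sum_distrib_left)
    also have "\<dots> \<le> \<rho> ^ 2 / 4 ^ k * (24 * real g * real (2 ^ Suc k) ^ 2 * sqrt (real h))"
      by (intro mult_left_mono sum_dyadic_block_le h g y c) (use Z in \<open>auto simp: B_def\<close>)
    also have "real (2 ^ Suc k) ^ 2 = 4 * 4 ^ k"
      by (simp add: power_mult_distrib power2_eq_square flip: power_mult_distrib)
    finally show ?thesis by simp
  qed
  have "Z = (\<Union>k<K. B k)"
  proof (intro equalityI subsetI)
    fix z assume z: "z \<in> Z"
    then have z0: "z > 0" using Z(2)[OF z] y by linarith
    obtain k where k: "2 ^ k \<le> z" "z < 2 ^ (k + 1)" using ex_power_ivl1[of 2 z] z0 by auto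
    then have "(2::nat) ^ k < 2 ^ K" using Z(2)[OF z] by linarith
    then have "k < K" by simp
    then show "z \<in> (\<Union>k<K. B k)" using k z by (auto simp: B_def)
  qed (auto simp: B_def)
  then have "(\<Sum>z\<in>Z. 1 / real (totient z) ^ 2 * ?S z) \<le> (\<Sum>k<K. \<Sum>z\<in>B k. 1 / real (totient z) ^ 2 * ?S z)"
  proof -
    assume *: "Z = (\<Union>k<K. B k)"
    show ?thesis
    proof (subst *, rule order_eq_refl, rule sum.UNION_disjoint)
      show "\<forall>i\<in>{..<K}. \<forall>j\<in>{..<K}. i \<noteq> j \<longrightarrow> B i \<inter> B j = {}"
      proof (intro ballI impI)
        fix i j :: nat assume "i \<noteq> j"
        then have "(2::nat) ^ Suc i \<le> 2 ^ j \<or> (2::nat) ^ Suc j \<le> 2 ^ i"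
          by (metis linorder_neqE_nat Suc_leI one_le_numeral power_increasing)
        then show "B i \<inter> B j = {}" unfolding B_def by fastforce
      qed
    qed (use Z in \<open>auto simp: B_def\<close>)
  qed
  also have "\<dots> \<le> (\<Sum>k<K. 96 * \<rho> ^ 2 * real g * sqrt (real h))" by (intro sum_mono block)
  finally show ?thesis by simp
qed

section \<open>Triples of fractions with integral sum\<close>

definition pair_sum :: "nat \<Rightarrow> nat \<Rightarrow> nat \<Rightarrow> nat \<Rightarrow> real" where
  "pair_sum h q1 q2 q3 =
     (\<Sum>(a1, a2, a3)\<in>residue_triples q1 q2 q3. psi (expsum_bound h q1 a1) * psi (expsum_bound h q3 a3))"

definition triple_sum :: "nat \<Rightarrow> nat \<Rightarrow> nat \<Rightarrow> nat \<Rightarrow> real" where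
  "triple_sum h q1 q2 q3 =
     (\<Sum>(a1, a2, a3)\<in>residue_triples q1 q2 q3. expsum_bound h q1 a1 * expsum_bound h q2 a2 * expsum_bound h q3 a3)"

lemma finite_residue_triples [simp]: "finite (residue_triples q1 q2 q3)"
  by (rule finite_subset[of _ "{..q1} \<times> {..q2} \<times> {..q3}"]) (auto simp: residue_triples_def)

lemma residue_triples_swap12:
  "(a2, a1, a3) \<in> residue_triples q2 q1 q3 \<longleftrightarrow> (a1, a2, a3) \<in> residue_triples q1 q2 q3"
  by (auto simp: residue_triples_def add_ac)

lemma residue_triples_swap23:
  "(a1, a3, a2) \<in> residue_triples q1 q3 q2 \<longleftrightarrow> (a1, a2, a3) \<in> residue_triples q1 q2 q3"
  by (auto simp: residue_triples_def add_ac)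

lemma triple_sum_swap12: "triple_sum h q2 q1 q3 = triple_sum h q1 q2 q3"
  unfolding triple_sum_def
  by (rule sum.reindex_bij_witness[of _ "\<lambda>(a, b, c). (b, a, c)" "\<lambda>(a, b, c). (b, a, c)"])
    (auto simp: residue_triples_swap12 mult_ac)

lemma triple_sum_swap23: "triple_sum h q1 q3 q2 = triple_sum h q1 q2 q3"
  unfolding triple_sum_def
  by (rule sum.reindex_bij_witness[of _ "\<lambda>(a, b, c). (a, c, b)" "\<lambda>(a, b, c). (a, c, b)"])
    (auto simp: residue_triples_swap23 mult_ac)

lemma pair_sum_nonneg [simp]: "pair_sum h q1 q2 q3 \<ge> 0"
  unfolding pair_sum_def by (intro sum_nonneg) auto

lemma residue_triples_pos_less:
  assumes "(a1, a2, a3) \<in> residue_triples q1 q2 q3" "q1 > 1" "q2 > 1" "q3 > 1"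
  shows "0 < a1" "a1 < q1" "0 < a2" "a2 < q2" "0 < a3" "a3 < q3"
  using assms by (auto simp: residue_triples_def le_less)

lemma of_nat_ratio_pos: "0 < a \<Longrightarrow> a < q \<Longrightarrow> 0 < real a / real q"
  by simp

lemma of_nat_ratio_less_1: "a < q \<Longrightarrow> real a / real q < 1"
  by simp

lemma expsum_bound_eq_min:
  assumes "0 < a" "a < q"
  shows "expsum_bound h q a = min (real h) (1 / min (real a / real q) (1 - real a / real q))"
proof -
  have "min (real a / real q) (1 - real a / real q) = real (min a (q - a)) / real q"
    using assms by (auto simp: min_def field_simps of_nat_diff)
  then show ?thesis by (simp add: expsum_bound_def)
qed

lemma triple_sum_le_pair_sums:
  assumes "h > 0" "q1 > 1" "q2 > 1" "q3 > 1"
  shows "triple_sum h q1 q2 q3 \<le> 2 * (pair_sum h q1 q2 q3 + pair_sum h q2 q1 q3)"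
proof -
  have swap: "pair_sum h q2 q1 q3 =
      (\<Sum>(a1, a2, a3)\<in>residue_triples q1 q2 q3. psi (expsum_bound h q2 a2) * psi (expsum_bound h q3 a3))"
    unfolding pair_sum_def
    by (rule sum.reindex_bij_witness[of _ "\<lambda>(a, b, c). (b, a, c)" "\<lambda>(a, b, c). (b, a, c)"])
      (auto simp: residue_triples_swap12)
  have "triple_sum h q1 q2 q3 \<le> (\<Sum>(a1, a2, a3)\<in>residue_triples q1 q2 q3.
     2 * (psi (expsum_bound h q1 a1) * psi (expsum_bound h q3 a3) + psi (expsum_bound h q2 a2) * psi (expsum_bound h q3 a3)))"
    unfolding triple_sum_def
  proof (rule sum_mono, clarify)
    fix a1 a2 a3 assume a: "(a1, a2, a3) \<in> residue_triples q1 q2 q3"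
    note b = residue_triples_pos_less[OF a assms(2-4)]
    let ?t1 = "real a1 / real q1" and ?t2 = "real a2 / real q2" and ?t3 = "real a3 / real q3"
    have t: "0 < ?t1" "?t1 < 1" "0 < ?t2" "?t2 < 1" "0 < ?t3" "?t3 < 1" using b assms by auto
    have "?t1 + ?t2 + ?t3 \<in> \<int>" using a by (auto simp: residue_triples_def)
    then obtain k :: int where k: "?t1 + ?t2 + ?t3 = of_int k" by (auto elim: Ints_cases)
    \<comment> \<open>Three fractions in (0, 1) with integral sum add up to 1 or 2, and in either
      case the distances to the nearest integer obey the triangle inequality.\<close>
    then have "(0::real) < of_int k" "of_int k < (3::real)" using t by linarith+
    then have "k = 1 \<or> k = 2" by linarith
    then have "min ?t3 (1 - ?t3) \<le> min ?t1 (1 - ?t1) + min ?t2 (1 - ?t2)"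
      using k t by (auto simp: min_def)
    then show "expsum_bound h q1 a1 * expsum_bound h q2 a2 * expsum_bound h q3 a3 \<le>
      2 * (psi (expsum_bound h q1 a1) * psi (expsum_bound h q3 a3) + psi (expsum_bound h q2 a2) * psi (expsum_bound h q3 a3))"
      unfolding expsum_bound_eq_min[OF b(1,2)] expsum_bound_eq_min[OF b(3,4)] expsum_bound_eq_min[OF b(5,6)]
      using t assms by (intro prod_le_psi_pairs) auto
  qed
  also have "\<dots> = 2 * (pair_sum h q1 q2 q3 + pair_sum h q2 q1 q3)"
    unfolding swap by (simp add: pair_sum_def case_prod_unfold sum.distrib sum_distrib_left)
  finally show ?thesis .
qed

text \<open>Clearing denominators makes q1 divide a1 q2 q3, and a1 is a unit modulo q1. With the
  swap lemmas this gives all three divisibilities needed for the parametrization.\<close>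

lemma residue_triples_dvd:
  assumes "(a1, a2, a3) \<in> residue_triples q1 q2 q3"
  shows "q1 dvd q2 * q3"
proof -
  have pos: "q1 > 0" "q2 > 0" "q3 > 0" and cop: "coprime a1 q1"
    and I: "real a1 / real q1 + real a2 / real q2 + real a3 / real q3 \<in> \<int>"
    using assms by (auto simp: residue_triples_def coprime_iff_gcd_eq_1)
  then obtain k :: int where k: "real a1 / real q1 + real a2 / real q2 + real a3 / real q3 = of_int k"
    by (auto elim: Ints_cases)
  have "real a1 * real q2 * real q3 =
      real q1 * (of_int k * real q2 * real q3 - real a2 * real q3 - real a3 * real q2)"
    unfolding k[symmetric] using pos by (simp add: field_simps)
  then have "of_int (int a1 * (int q2 * int q3)) =
      (of_int (int q1 * (k * int q2 * int q3 - int a2 * int q3 - int a3 * int q2)) :: real)"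
    by (simp add: mult_ac)
  then have "int q1 dvd int a1 * (int q2 * int q3)" unfolding of_int_eq_iff by simp
  then have "q1 dvd a1 * (q2 * q3)" by (metis int_dvd_int_iff of_nat_mult)
  then show ?thesis using cop by (simp add: coprime_commute coprime_dvd_mult_right_iff)
qed

text \<open>With n = g k and m = g l for g = gcd n m, the cofactor k is coprime to l and divides g
  l^2, hence g. Then k^2 divides n, so k = 1.\<close>

lemma squarefree_dvd_square_imp_dvd:
  fixes n m :: nat
  assumes "squarefree n" "n dvd m ^ 2"
  shows "n dvd m"
proof -
  define g where "g = gcd n m"
  have g0: "g > 0" unfolding g_def using assms(1) by (auto intro: Nat.gr0I)
  obtain k l where kl: "n = g * k" "m = g * l" "coprime k l"
    using gcd_coprime_exists[of n m] g0 unfolding g_def by (auto simp: mult.commute)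
  have "g * k dvd g * (g * l ^ 2)" using assms(2) kl by (simp add: power2_eq_square mult_ac)
  then have "k dvd g * l ^ 2" using g0 by simp
  then have "k dvd g" using kl(3) by (simp add: coprime_dvd_mult_left_iff)
  then have "k ^ 2 dvd n" unfolding kl(1) power2_eq_square by (rule mult_dvd_mono) simp
  then have "k = 1" using assms(1) squarefreeD by fastforce
  then show ?thesis using kl by simp
qed

text \<open>Take g as the gcd of all three and x, y, z as the pairwise gcds divided by g. By
  squarefreeness each q_i is the lcm of its gcds with the other two; these have gcd g, so lcm * gcd
  = product gives the formula. The gcds are part of the conclusion because the ordering y <= z is
  later expressed through them.\<close>

lemma squarefree_triple_parametrization:
  fixes q1 q2 q3 :: nat
  assumes sf: "squarefree q1" "squarefree q2" "squarefree q3"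
    and dvd: "q1 dvd q2 * q3" "q2 dvd q1 * q3" "q3 dvd q1 * q2"
  obtains g x y z where "q1 = g * y * z" "q2 = g * x * z" "q3 = g * x * y"
    "gcd q1 q2 = g * z" "gcd q1 q3 = g * y"
proof -
  have lcm: "lcm (gcd a b) (gcd a c) = a" if "squarefree a" "a dvd b * c" for a b c :: nat
  proof -
    \<comment> \<open>As b c = gcd * lcm and gcd divides lcm, a squarefree divisor of b c divides
      the lcm; distributivity of gcd over lcm then finishes.\<close>
    have "b * c dvd lcm b c ^ 2"
      unfolding prod_gcd_lcm_nat[of b c] power2_eq_square
      by (intro mult_dvd_mono dvd_trans[OF gcd_dvd1 dvd_lcm1] dvd_refl)
    then have "a dvd lcm b c" using that dvd_trans squarefree_dvd_square_imp_dvd by blast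
    then show ?thesis by (metis gcd_lcm_distrib gcd_nat.absorb1)
  qed
  define g where "g = gcd q1 (gcd q2 q3)"
  have g0: "g > 0" unfolding g_def using sf(1) by (auto intro: Nat.gr0I)
  have "g dvd gcd q1 q2" "g dvd gcd q1 q3" "g dvd gcd q2 q3" by (auto simp: g_def intro: dvd_trans[OF gcd_dvd2])
  then obtain z y x where *: "gcd q1 q2 = g * z" "gcd q1 q3 = g * y" "gcd q2 q3 = g * x"
    unfolding dvd_def by blast
  have eq: "a = g * u * v"
    if "lcm (g * u) (g * v) = a" "gcd (g * u) (g * v) = g" for a u v
  proof -
    have "(g * u) * (g * v) = g * a" using prod_gcd_lcm_nat[of "g * u" "g * v"] that by simp
    then show ?thesis using g0 by (simp add: mult_ac)
  qed
  show ?thesis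
  proof
    have "lcm (gcd q1 q3) (gcd q1 q2) = q1" using lcm[of q1 q3 q2] sf dvd by (simp add: mult.commute)
    moreover have "gcd (gcd q1 q3) (gcd q1 q2) = g" by (simp add: g_def gcd.assoc gcd.commute gcd.left_commute)
    ultimately show "q1 = g * y * z" unfolding * by (rule eq)
    have "lcm (gcd q2 q3) (gcd q1 q2) = q2"
      using lcm[of q2 q3 q1] sf dvd by (simp add: mult.commute gcd.commute)
    moreover have "gcd (gcd q2 q3) (gcd q1 q2) = g" by (simp add: g_def gcd.assoc gcd.commute gcd.left_commute)
    ultimately show "q2 = g * x * z" unfolding * by (rule eq)
    have "lcm (gcd q2 q3) (gcd q1 q3) = q3"
      using lcm[of q3 q2 q1] sf dvd by (simp add: mult.commute gcd.commute)
    moreover have "gcd (gcd q2 q3) (gcd q1 q3) = g" by (simp add: g_def gcd.assoc gcd.commute gcd.left_commute)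
    ultimately show "q3 = g * x * y" unfolding * by (rule eq)
  qed (use * in auto)
qed

text \<open>A triple is recovered from (a_3, a_1): two candidates for a_2/q_2 differ by an integer
  and both lie in (0, 1). Coprimality of c and y is retained because the averaging over z inverts c
  modulo y.\<close>

lemma pair_sum_parametrized_le:
  assumes "g * y * z > 1" "g * x * z > 1" "g * x * y > 1"
  shows "pair_sum h (g * y * z) (g * x * z) (g * x * y) \<le>
    (\<Sum>c | c \<in> {0<..<g * x * y} \<and> coprime c y. psi (expsum_bound h (g * x * y) c) *
       (\<Sum>a\<in>admissible g x y z c. psi (expsum_bound h (g * y * z) a)))"
proof -
  let ?q1 = "g * y * z" and ?q2 = "g * x * z" and ?q3 = "g * x * y"
  let ?R = "residue_triples ?q1 ?q2 ?q3"
  let ?C = "{c. c \<in> {0<..<?q3} \<and> coprime c y}"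
  let ?f = "\<lambda>c a. psi (expsum_bound h ?q3 c) * psi (expsum_bound h ?q1 a)"
  define i where "i = (\<lambda>(a1::nat, a2::nat, a3::nat). (a3, a1))"
  have pos: "g > 0" "x > 0" "y > 0" "z > 0" using assms by (auto intro!: Nat.gr0I)
  have inj: "inj_on i ?R"
  proof (rule inj_onI)
    fix p p' assume p: "p \<in> ?R" "p' \<in> ?R" "i p = i p'"
    obtain a1 a2 a3 b1 b2 b3 where pp: "p = (a1, a2, a3)" "p' = (b1, b2, b3)"
      by (metis prod_cases3)
    then have a: "(a1, a2, a3) \<in> ?R" and b: "(b1, b2, b3) \<in> ?R" and "i (a1, a2, a3) = i (b1, b2, b3)"
      using p by auto
    then have 13: "a1 = b1" "a3 = b3" by (auto simp: i_def)
    have "(real a1 / real ?q1 + real a2 / real ?q2 + real a3 / real ?q3)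
        - (real b1 / real ?q1 + real b2 / real ?q2 + real b3 / real ?q3) \<in> \<int>"
      using a b by (intro Ints_diff) (auto simp: residue_triples_def)
    then have "real a2 / real ?q2 - real b2 / real ?q2 \<in> \<int>" using 13 by simp
    then obtain k :: int where k: "real a2 / real ?q2 - real b2 / real ?q2 = of_int k"
      by (auto elim: Ints_cases)
    have "0 < real a2 / real ?q2" "real a2 / real ?q2 < 1" "0 < real b2 / real ?q2" "real b2 / real ?q2 < 1"
      using residue_triples_pos_less[OF a assms] residue_triples_pos_less[OF b assms]
      by (blast intro: of_nat_ratio_pos of_nat_ratio_less_1)+
    then have "(-1::real) < of_int k" "of_int k < (1::real)" using k by linarith+
    then have "k = 0" by linarith
    then have "real a2 / real ?q2 = real b2 / real ?q2" using k by simp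
    then have "a2 = b2" using pos by simp
    then show "p = p'" using 13 pp by simp
  qed
  have sub: "i ` ?R \<subseteq> (SIGMA c:?C. admissible g x y z c)"
  proof (clarsimp simp: i_def, intro conjI)
    fix a1 a2 a3 assume a: "(a1, a2, a3) \<in> ?R"
    note b = residue_triples_pos_less[OF a assms]
    show "0 < a3" "a3 < g * x * y" using b by auto
    have "coprime a3 (g * x * y)" using a by (auto simp: residue_triples_def coprime_iff_gcd_eq_1)
    then show "coprime a3 y" by simp
    have "real a1 / real ?q1 + real a2 / real ?q2 + real a3 / real ?q3 \<in> \<int>"
      using a by (auto simp: residue_triples_def)
    then obtain k :: int where k: "real a1 / real ?q1 + real a2 / real ?q2 + real a3 / real ?q3 = of_int k"
      by (auto elim: Ints_cases)
    \<comment> \<open>The integrality relation multiplied by gxyz and solved for the terms in a_1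
      and a_3.\<close>
    have "real a1 * real x + real a3 * real z
        = real y * (of_int k * real g * real x * real z - real a2)"
      unfolding k[symmetric] using pos by (simp add: field_simps)
    then have "of_int (int a1 * int x + int a3 * int z)
        = (of_int (int y * (k * int g * int x * int z - int a2)) :: real)" by simp
    then have "int y dvd int a1 * int x + int a3 * int z" unfolding of_int_eq_iff by simp
    then have "y dvd a1 * x + a3 * z" by (metis int_dvd_int_iff of_nat_mult of_nat_add)
    then show "a1 \<in> admissible g x y z a3" using b by (simp add: admissible_def)
  qed
  have fin: "finite ?C" by (rule finite_subset[of _ "{0<..<?q3}"]) auto
  have "pair_sum h ?q1 ?q2 ?q3 = (\<Sum>p\<in>?R. case i p of (c, a) \<Rightarrow> ?f c a)"
    unfolding pair_sum_def by (intro sum.cong refl) (auto simp: i_def)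
  also have "\<dots> = (\<Sum>p\<in>i ` ?R. case p of (c, a) \<Rightarrow> ?f c a)"
    by (subst sum.reindex[OF inj]) simp
  also have "\<dots> \<le> (\<Sum>p\<in>(SIGMA c:?C. admissible g x y z c). case p of (c, a) \<Rightarrow> ?f c a)"
    by (rule sum_mono2[OF _ sub]) (use fin in auto)
  also have "\<dots> = (\<Sum>c\<in>?C. \<Sum>a\<in>admissible g x y z c. ?f c a)"
    by (subst sum.Sigma) (use fin in auto)
  finally show ?thesis by (simp add: sum_distrib_left)
qed

section \<open>Reduction to weighted sums over pairs\<close>

lemma unit_exp_add: "unit_exp (x + y) = unit_exp x * unit_exp y"
  by (simp add: unit_exp_def distrib_left exp_add)

lemma sum_swap3:
  "(\<Sum>a\<in>A. \<Sum>b\<in>B. \<Sum>c\<in>C. \<Sum>r\<in>R. g a b c r) = (\<Sum>r\<in>R. \<Sum>a\<in>A. \<Sum>b\<in>B. \<Sum>c\<in>C. g a b c r)"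
  by (rule trans[OF _ sum.swap], rule sum.cong[OF refl],
      rule trans[OF _ sum.swap], rule sum.cong[OF refl], rule sum.swap)

text \<open>Once the sums over the q_i are moved outside and those over the numerators past the d_i,
  the sums over d_1, d_2, d_3 factor into three exponential sums. From there on the triangle
  inequality suffices.\<close>

lemma norm_V3_le:
  "norm (V3 q h) \<le> (\<Sum>q1\<in>nontrivial_divisors q. \<Sum>q2\<in>nontrivial_divisors q. \<Sum>q3\<in>nontrivial_divisors q.
     triple_sum h q1 q2 q3 / (real (totient q1) * real (totient q2) * real (totient q3)))"
proof -
  define R where "R = nontrivial_divisors q"
  define D where "D = {1..int h}"
  define w where "w = (\<lambda>q1 q2 q3. (moebius_mu q1 / real (totient q1)) *
    (moebius_mu q2 / real (totient q2)) * (moebius_mu q3 / real (totient q3)))"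
  define E where "E = (\<lambda>a q. \<Sum>d\<in>D. unit_exp (real a * of_int d / real q))"
  let ?f = "\<lambda>q1 q2 q3 d1 d2 d3 (a1, a2, a3). unit_exp (real a1 * of_int d1 / real q1 +
               real a2 * of_int d2 / real q2 + real a3 * of_int d3 / real q3)"
  let ?T = residue_triples
  have "V3 q h = (\<Sum>d1\<in>D. \<Sum>d2\<in>D. \<Sum>d3\<in>D. \<Sum>q1\<in>R. \<Sum>q2\<in>R. \<Sum>q3\<in>R.
      of_real (w q1 q2 q3) * (\<Sum>p\<in>?T q1 q2 q3. ?f q1 q2 q3 d1 d2 d3 p))"
    by (simp add: V3_def R_def D_def w_def)
  also have "\<dots> = (\<Sum>q1\<in>R. \<Sum>d1\<in>D. \<Sum>d2\<in>D. \<Sum>d3\<in>D. \<Sum>q2\<in>R. \<Sum>q3\<in>R.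
      of_real (w q1 q2 q3) * (\<Sum>p\<in>?T q1 q2 q3. ?f q1 q2 q3 d1 d2 d3 p))"
    by (rule sum_swap3)
  also have "\<dots> = (\<Sum>q1\<in>R. \<Sum>q2\<in>R. \<Sum>d1\<in>D. \<Sum>d2\<in>D. \<Sum>d3\<in>D. \<Sum>q3\<in>R.
      of_real (w q1 q2 q3) * (\<Sum>p\<in>?T q1 q2 q3. ?f q1 q2 q3 d1 d2 d3 p))"
    by (rule sum.cong[OF refl], rule sum_swap3)
  also have "\<dots> = (\<Sum>q1\<in>R. \<Sum>q2\<in>R. \<Sum>q3\<in>R. \<Sum>d1\<in>D. \<Sum>d2\<in>D. \<Sum>d3\<in>D.
      of_real (w q1 q2 q3) * (\<Sum>p\<in>?T q1 q2 q3. ?f q1 q2 q3 d1 d2 d3 p))"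
    by (rule sum.cong[OF refl], rule sum.cong[OF refl], rule sum_swap3)
  also have "\<dots> = (\<Sum>q1\<in>R. \<Sum>q2\<in>R. \<Sum>q3\<in>R. of_real (w q1 q2 q3) *
      (\<Sum>d1\<in>D. \<Sum>d2\<in>D. \<Sum>d3\<in>D. \<Sum>p\<in>?T q1 q2 q3. ?f q1 q2 q3 d1 d2 d3 p))"
    by (simp only: sum_distrib_left)
  also have "\<dots> = (\<Sum>q1\<in>R. \<Sum>q2\<in>R. \<Sum>q3\<in>R. of_real (w q1 q2 q3) *
      (\<Sum>p\<in>?T q1 q2 q3. \<Sum>d1\<in>D. \<Sum>d2\<in>D. \<Sum>d3\<in>D. ?f q1 q2 q3 d1 d2 d3 p))"
    by (rule sum.cong[OF refl], rule sum.cong[OF refl], rule sum.cong[OF refl],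
        rule arg_cong2[where f = "(*)", OF refl sum_swap3])
  finally have eq: "V3 q h = (\<Sum>q1\<in>R. \<Sum>q2\<in>R. \<Sum>q3\<in>R. of_real (w q1 q2 q3) *
      (\<Sum>p\<in>?T q1 q2 q3. \<Sum>d1\<in>D. \<Sum>d2\<in>D. \<Sum>d3\<in>D. ?f q1 q2 q3 d1 d2 d3 p))" .
  have "norm (V3 q h) \<le> (\<Sum>q1\<in>R. \<Sum>q2\<in>R. \<Sum>q3\<in>R.
      triple_sum h q1 q2 q3 / (real (totient q1) * real (totient q2) * real (totient q3)))"
    unfolding eq
  proof (intro sum_norm_le)
    fix q1 q2 q3 assume "q1 \<in> R" "q2 \<in> R" "q3 \<in> R"
    then have q: "q1 > 1" "q2 > 1" "q3 > 1" by (auto simp: R_def nontrivial_divisors_def)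
    have mu: "\<bar>moebius_mu n / real (totient n)\<bar> \<le> 1 / real (totient n)" for n
      by (simp add: moebius_mu_def divide_right_mono power_abs)
    have "\<bar>w q1 q2 q3\<bar> \<le> 1 / real (totient q1) * (1 / real (totient q2)) * (1 / real (totient q3))"
      unfolding w_def abs_mult by (intro mult_mono mu) auto
    then have wb: "\<bar>w q1 q2 q3\<bar> \<le> 1 / (real (totient q1) * real (totient q2) * real (totient q3))"
      by simp
    have "norm (\<Sum>p\<in>?T q1 q2 q3. \<Sum>d1\<in>D. \<Sum>d2\<in>D. \<Sum>d3\<in>D. ?f q1 q2 q3 d1 d2 d3 p)
      \<le> triple_sum h q1 q2 q3"
      unfolding triple_sum_def
    proof (rule sum_norm_le, clarify)
      fix a1 a2 a3 assume a: "(a1, a2, a3) \<in> ?T q1 q2 q3"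
      have "(\<Sum>d1\<in>D. \<Sum>d2\<in>D. \<Sum>d3\<in>D. unit_exp (real a1 * of_int d1 / real q1 +
               real a2 * of_int d2 / real q2 + real a3 * of_int d3 / real q3))
         = E a1 q1 * E a2 q2 * E a3 q3"
      proof -
        have "E a1 q1 * (E a2 q2 * E a3 q3) = (\<Sum>d1\<in>D. \<Sum>d2\<in>D. \<Sum>d3\<in>D.
            unit_exp (real a1 * of_int d1 / real q1) *
            (unit_exp (real a2 * of_int d2 / real q2) * unit_exp (real a3 * of_int d3 / real q3)))"
          unfolding E_def sum_product by (simp only: sum_distrib_left sum_distrib_right)
        then show ?thesis by (simp only: unit_exp_add mult.assoc)
      qed
      also have "norm \<dots> \<le> expsum_bound h q1 a1 * expsum_bound h q2 a2 * expsum_bound h q3 a3"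
        unfolding norm_mult E_def D_def using residue_triples_pos_less[OF a q]
        by (intro mult_mono norm_sum_unit_exp_le_expsum_bound) auto
      finally show "norm (\<Sum>d1\<in>D. \<Sum>d2\<in>D. \<Sum>d3\<in>D. unit_exp (real a1 * of_int d1 / real q1 +
               real a2 * of_int d2 / real q2 + real a3 * of_int d3 / real q3))
         \<le> expsum_bound h q1 a1 * expsum_bound h q2 a2 * expsum_bound h q3 a3" .
    qed
    then have "norm (of_real (w q1 q2 q3) *
        (\<Sum>p\<in>?T q1 q2 q3. \<Sum>d1\<in>D. \<Sum>d2\<in>D. \<Sum>d3\<in>D. ?f q1 q2 q3 d1 d2 d3 p))
      \<le> 1 / (real (totient q1) * real (totient q2) * real (totient q3)) * triple_sum h q1 q2 q3"
      unfolding norm_mult norm_of_real using wb by (intro mult_mono) auto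
    then show "norm (of_real (w q1 q2 q3) *
        (\<Sum>p\<in>?T q1 q2 q3. \<Sum>d1\<in>D. \<Sum>d2\<in>D. \<Sum>d3\<in>D. ?f q1 q2 q3 d1 d2 d3 p))
      \<le> triple_sum h q1 q2 q3 / (real (totient q1) * real (totient q2) * real (totient q3))"
      by simp
  qed
  then show ?thesis by (simp only: R_def)
qed

text \<open>In the parametrization the two gcds are gy and gz, so the condition reads y <= z. The
  default 0 lets all sums run over full ranges that are symmetric in the three moduli.\<close>

definition weighted_pair_sum :: "nat \<Rightarrow> nat \<Rightarrow> nat \<Rightarrow> nat \<Rightarrow> real" where
  "weighted_pair_sum h q1 q2 q3 = (if gcd q1 q3 \<le> gcd q1 q2
     then pair_sum h q1 q2 q3 / (real (totient q1) * real (totient q2) * real (totient q3)) else 0)"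

lemma weighted_pair_sum_nonneg [simp]: "weighted_pair_sum h q1 q2 q3 \<ge> 0"
  by (simp add: weighted_pair_sum_def)

text \<open>The pair with the largest gcd takes positions 1 and 2. Both pair sums from
  \<open>triple_sum_le_pair_sums\<close> then meet the gcd condition; allowing all six permutations
  avoids naming that pair.\<close>

lemma weighted_triple_sum_le:
  assumes "h > 0" "q1 > 1" "q2 > 1" "q3 > 1"
  defines "K \<equiv> weighted_pair_sum h"
  shows "triple_sum h q1 q2 q3 / (real (totient q1) * real (totient q2) * real (totient q3))
    \<le> 2 * (K q1 q2 q3 + K q2 q1 q3 + K q1 q3 q2 + K q3 q1 q2 + K q2 q3 q1 + K q3 q2 q1)"
proof -
  let ?W = "\<lambda>q1 q2 q3. triple_sum h q1 q2 q3 / (real (totient q1) * real (totient q2) * real (totient q3))"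
  have main: "?W a b c \<le> 2 * (K a b c + K b a c)"
    if "a > 1" "b > 1" "c > 1" "gcd a c \<le> gcd a b" "gcd b c \<le> gcd a b" for a b c
  proof -
    have "?W a b c \<le> 2 * (pair_sum h a b c + pair_sum h b a c) / (real (totient a) * real (totient b) * real (totient c))"
      using that assms by (intro divide_right_mono triple_sum_le_pair_sums) auto
    also have "\<dots> = 2 * (K a b c + K b a c)"
      using that by (simp add: K_def weighted_pair_sum_def gcd.commute mult_ac add_divide_distrib)
    finally show ?thesis .
  qed
  have ineq: "2 * (a + b) \<le> 2 * (a + b + c + d + e + f)" "2 * (c + d) \<le> 2 * (a + b + c + d + e + f)"
      "2 * (e + f) \<le> 2 * (a + b + c + d + e + f)"
    if "0 \<le> a" "0 \<le> b" "0 \<le> c" "0 \<le> d" "0 \<le> e" "0 \<le> f" for a b c d e f :: real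
    using that by simp_all
  have nn: "K a b c \<ge> 0" for a b c by (simp add: K_def)
  consider "gcd q1 q3 \<le> gcd q1 q2 \<and> gcd q2 q3 \<le> gcd q1 q2"
    | "gcd q1 q2 \<le> gcd q1 q3 \<and> gcd q2 q3 \<le> gcd q1 q3"
    | "gcd q1 q2 \<le> gcd q2 q3 \<and> gcd q1 q3 \<le> gcd q2 q3" by linarith
  then show ?thesis
  proof cases
    case 1
    then have "?W q1 q2 q3 \<le> 2 * (K q1 q2 q3 + K q2 q1 q3)" using assms by (intro main) auto
    then show ?thesis
      by (rule order_trans, intro ineq nn)
  next
    case 2
    then have "?W q1 q3 q2 \<le> 2 * (K q1 q3 q2 + K q3 q1 q2)"
      using assms by (intro main) (auto simp: gcd.commute)
    moreover have "?W q1 q2 q3 = ?W q1 q3 q2" by (simp add: triple_sum_swap23[of h q1 q2 q3] mult_ac)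
    ultimately have "?W q1 q2 q3 \<le> 2 * (K q1 q3 q2 + K q3 q1 q2)" by (simp only:)
    then show ?thesis
      by (rule order_trans, intro ineq nn)
  next
    case 3
    then have "?W q2 q3 q1 \<le> 2 * (K q2 q3 q1 + K q3 q2 q1)"
      using assms by (intro main) (auto simp: gcd.commute)
    moreover have "triple_sum h q1 q2 q3 = triple_sum h q2 q3 q1"
      by (metis triple_sum_swap12 triple_sum_swap23)
    then have "?W q1 q2 q3 = ?W q2 q3 q1" by (simp add: mult_ac)
    ultimately have "?W q1 q2 q3 \<le> 2 * (K q2 q3 q1 + K q3 q2 q1)" by (simp only:)
    then show ?thesis
      by (rule order_trans, intro ineq nn)
  qed
qed

text \<open>All six permutations have the same total over the symmetric range, so the constant is 12
  = 2 * 6.\<close>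

lemma norm_V3_le_weighted_pair_sums:
  assumes "h > 0"
  shows "norm (V3 q h) \<le> 12 * (\<Sum>q1\<in>nontrivial_divisors q. \<Sum>q2\<in>nontrivial_divisors q.
    \<Sum>q3\<in>nontrivial_divisors q. weighted_pair_sum h q1 q2 q3)"
proof -
  let ?R = "nontrivial_divisors q" and ?K = "weighted_pair_sum h"
  let ?S = "\<Sum>q1\<in>?R. \<Sum>q2\<in>?R. \<Sum>q3\<in>?R. ?K q1 q2 q3"
  have p213: "(\<Sum>q1\<in>?R. \<Sum>q2\<in>?R. \<Sum>q3\<in>?R. ?K q2 q1 q3) = ?S" by (rule sum.swap)
  have p132: "(\<Sum>q1\<in>?R. \<Sum>q2\<in>?R. \<Sum>q3\<in>?R. ?K q1 q3 q2) = ?S"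
    by (rule sum.cong[OF refl], rule sum.swap)
  have p312: "(\<Sum>q1\<in>?R. \<Sum>q2\<in>?R. \<Sum>q3\<in>?R. ?K q3 q1 q2) = ?S"
    by (rule trans[OF _ p213], rule sum.cong[OF refl], rule sum.swap)
  have p231: "(\<Sum>q1\<in>?R. \<Sum>q2\<in>?R. \<Sum>q3\<in>?R. ?K q2 q3 q1) = ?S"
    by (rule trans[OF sum.swap p132])
  have p321: "(\<Sum>q1\<in>?R. \<Sum>q2\<in>?R. \<Sum>q3\<in>?R. ?K q3 q2 q1) = ?S"
    by (rule trans[OF sum.swap p312])
  have "norm (V3 q h) \<le> (\<Sum>q1\<in>?R. \<Sum>q2\<in>?R. \<Sum>q3\<in>?R.
     2 * (?K q1 q2 q3 + ?K q2 q1 q3 + ?K q1 q3 q2 + ?K q3 q1 q2 + ?K q2 q3 q1 + ?K q3 q2 q1))"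
    by (rule order_trans[OF norm_V3_le], intro sum_mono weighted_triple_sum_le)
      (use assms in \<open>auto simp: nontrivial_divisors_def\<close>)
  also have "\<dots> = 2 * (?S + ?S + ?S + ?S + ?S + ?S)"
    unfolding sum_distrib_left[symmetric] sum.distrib p213 p132 p312 p231 p321 ..
  finally show ?thesis by simp
qed

section \<open>Summation in the parameters g, x, y, z\<close>

text \<open>Squarefreeness of the three products encodes pairwise coprimality of the parameters.
  With the default 0 they can range independently over the divisors of q.\<close>

definition parametrized_sum :: "nat \<Rightarrow> nat \<Rightarrow> nat \<Rightarrow> nat \<Rightarrow> nat \<Rightarrow> real" where
  "parametrized_sum h g x y z = (if squarefree (g * y * z) \<and> squarefree (g * x * z) \<and> squarefree (g * x * y)
      \<and> g * y * z > 1 \<and> g * x * z > 1 \<and> g * x * y > 1 \<and> y \<le> z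
    then pair_sum h (g * y * z) (g * x * z) (g * x * y) /
      (real (totient (g * y * z)) * real (totient (g * x * z)) * real (totient (g * x * y))) else 0)"

text \<open>By nonnegativity it is enough that every nonzero term has some preimage under
  \<open>i\<close>.\<close>

lemma sum_weighted_pair_sum_le:
  assumes "squarefree q"
  shows "(\<Sum>q1\<in>nontrivial_divisors q. \<Sum>q2\<in>nontrivial_divisors q.
    \<Sum>q3\<in>nontrivial_divisors q. weighted_pair_sum h q1 q2 q3)
    \<le> (\<Sum>g | g dvd q. \<Sum>x | x dvd q. \<Sum>y | y dvd q. \<Sum>z | z dvd q. parametrized_sum h g x y z)"
proof -
  let ?R = "nontrivial_divisors q"
  define D where "D = {d. d dvd q}"
  have q: "q > 0" using assms by (auto intro!: Nat.gr0I)
  have fin: "finite D" using q by (simp add: D_def)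
  have finR: "finite ?R" by (rule finite_subset[OF _ fin]) (auto simp: nontrivial_divisors_def D_def)
  define i where "i = (\<lambda>(g::nat, x, y, z). (g * y * z, g * x * z, g * x * y))"
  have "(\<Sum>(q1, q2, q3)\<in>?R \<times> ?R \<times> ?R. weighted_pair_sum h q1 q2 q3)
      = (\<Sum>(q1, q2, q3)\<in>{(q1, q2, q3) \<in> ?R \<times> ?R \<times> ?R. weighted_pair_sum h q1 q2 q3 \<noteq> 0}. weighted_pair_sum h q1 q2 q3)"
    by (rule sum.mono_neutral_right) (use finR in auto)
  also have "\<dots> \<le> (\<Sum>(g, x, y, z)\<in>D \<times> D \<times> D \<times> D. parametrized_sum h g x y z)"
  proof (rule sum_le_included[where i = i])
    show "finite {(q1, q2, q3) \<in> ?R \<times> ?R \<times> ?R. weighted_pair_sum h q1 q2 q3 \<noteq> 0}"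
      by (rule finite_subset[of _ "?R \<times> ?R \<times> ?R"]) (use finR in auto)
    show "\<forall>p\<in>{(q1, q2, q3) \<in> ?R \<times> ?R \<times> ?R. weighted_pair_sum h q1 q2 q3 \<noteq> 0}.
      \<exists>t\<in>D \<times> D \<times> D \<times> D. i t = p \<and> (case p of (q1, q2, q3) \<Rightarrow> weighted_pair_sum h q1 q2 q3)
        \<le> (case t of (g, x, y, z) \<Rightarrow> parametrized_sum h g x y z)"
    proof (clarify)
      fix q1 q2 q3 assume R: "q1 \<in> ?R" "q2 \<in> ?R" "q3 \<in> ?R" and nz: "weighted_pair_sum h q1 q2 q3 \<noteq> 0"
      have le: "gcd q1 q3 \<le> gcd q1 q2" and "pair_sum h q1 q2 q3 \<noteq> 0"
        using nz by (auto simp: weighted_pair_sum_def split: if_splits)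
      \<comment> \<open>A nonzero term has a triple of numerators, whose existence forces the
        divisibilities among the moduli.\<close>
      then have "residue_triples q1 q2 q3 \<noteq> {}" by (auto simp: pair_sum_def)
      then obtain a1 a2 a3 where a: "(a1, a2, a3) \<in> residue_triples q1 q2 q3" by auto
      have "(a2, a1, a3) \<in> residue_triples q2 q1 q3" using a by (simp only: residue_triples_swap12)
      moreover have "(a1, a3, a2) \<in> residue_triples q1 q3 q2" using a by (simp only: residue_triples_swap23)
      then have "(a3, a1, a2) \<in> residue_triples q3 q1 q2" by (simp only: residue_triples_swap12)
      ultimately have "q1 dvd q2 * q3" "q2 dvd q1 * q3" "q3 dvd q1 * q2"
        using a by (auto dest: residue_triples_dvd)
      moreover have sf: "squarefree q1" "squarefree q2" "squarefree q3"
        using R assms squarefree_mono by (auto simp: nontrivial_divisors_def)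
      ultimately obtain g x y z where eq: "q1 = g * y * z" "q2 = g * x * z" "q3 = g * x * y"
        "gcd q1 q2 = g * z" "gcd q1 q3 = g * y"
        using squarefree_triple_parametrization[of q1 q2 q3] by metis
      have gt: "q1 > 1" "q2 > 1" "q3 > 1" and dv: "q1 dvd q" "q2 dvd q"
        using R by (auto simp: nontrivial_divisors_def)
      have g: "g > 0" using gt eq(1) by (auto intro!: Nat.gr0I)
      have yz: "y \<le> z" using le g unfolding eq(4,5) by simp
      have "g dvd q1" "x dvd q2" "y dvd q1" "z dvd q1" unfolding eq(1,2) by auto
      then have t: "(g, x, y, z) \<in> D \<times> D \<times> D \<times> D" using dv dvd_trans by (auto simp: D_def)
      have "weighted_pair_sum h q1 q2 q3 = parametrized_sum h g x y z"
        using sf gt yz le unfolding weighted_pair_sum_def parametrized_sum_def eq(1-3) by simp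
      then show "\<exists>t\<in>D \<times> D \<times> D \<times> D. i t = (q1, q2, q3) \<and> weighted_pair_sum h q1 q2 q3
        \<le> (case t of (g, x, y, z) \<Rightarrow> parametrized_sum h g x y z)"
        by (intro bexI[OF _ t]) (auto simp: i_def eq(1-3))
    qed
  qed (use fin in \<open>auto simp: parametrized_sum_def\<close>)
  finally show ?thesis unfolding D_def by (simp add: sum.cartesian_product)
qed

text \<open>The split at gz = h: the part \<open>A\<close> uses the residue class of a_1 and costs a
  divisor sum \<open>M\<close>; the part \<open>B\<close> has z <= gz < h, so both the bound for
  z/phi(z) and a dyadic cover of length O(log h) apply. Both parts share the factor g sqrt
  h.\<close>

lemma sum_inner_le:
  fixes q h g x y c :: nat
  assumes h: "h \<ge> 2" and g: "g > 0" and y: "y > 0" and xy: "coprime x y" and cy: "coprime c y"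
    and Z: "finite Z" "\<And>z. z \<in> Z \<Longrightarrow> y \<le> z"
    and M: "\<And>A. A \<subseteq> Z \<Longrightarrow> (\<Sum>z\<in>A. real z / real (totient z) ^ 2) \<le> M"
  shows "(\<Sum>z\<in>Z. 1 / real (totient z) ^ 2 * (\<Sum>a\<in>admissible g x y z c. psi (expsum_bound h (g * y * z) a)))
    \<le> real g * sqrt (real h) * (14 * M + 384 * ln (real h) * (exp 13 * ln (ln (real h) + 3)) ^ 2)"
proof -
  let ?S = "\<lambda>z. 1 / real (totient z) ^ 2 * (\<Sum>a\<in>admissible g x y z c. psi (expsum_bound h (g * y * z) a))"
  let ?\<rho> = "exp 13 * ln (ln (real h) + 3)"
  define A B where "A = {z \<in> Z. h \<le> g * z}" and "B = {z \<in> Z. \<not> h \<le> g * z}"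
  have L: "ln (real h) \<ge> 1 / 2" by (rule ln_nat_ge_half[OF h])
  have "(\<Sum>z\<in>Z. ?S z) = (\<Sum>z\<in>A. ?S z) + (\<Sum>z\<in>B. ?S z)"
    by (subst sum.union_disjoint[symmetric]) (use Z in \<open>auto simp: A_def B_def intro!: sum.cong\<close>)
  also have "(\<Sum>z\<in>A. ?S z) \<le> (\<Sum>z\<in>A. 14 * real g * sqrt (real h) * (real z / real (totient z) ^ 2))"
  proof (rule sum_mono)
    fix z assume "z \<in> A"
    then have "(\<Sum>a\<in>admissible g x y z c. psi (expsum_bound h (g * y * z) a)) \<le> 14 * (real g * real z) * sqrt (real h)"
      using h y xy by (intro sum_psi_expsum_bound_admissible_le) (auto simp: A_def)
    then have "?S z \<le> 1 / real (totient z) ^ 2 * (14 * (real g * real z) * sqrt (real h))"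
      by (intro mult_left_mono) auto
    then show "?S z \<le> 14 * real g * sqrt (real h) * (real z / real (totient z) ^ 2)"
      by (simp add: mult_ac)
  qed
  also have "\<dots> = 14 * real g * sqrt (real h) * (\<Sum>z\<in>A. real z / real (totient z) ^ 2)"
    by (simp add: sum_distrib_left)
  also have "\<dots> \<le> 14 * real g * sqrt (real h) * M"
    by (intro mult_left_mono M) (auto simp: A_def)
  also have "(\<Sum>z\<in>B. ?S z) \<le> 96 * (4 * ln (real h)) * ?\<rho> ^ 2 * real g * sqrt (real h)"
  proof -
    \<comment> \<open>The number of dyadic blocks below h. As ln 2 and ln h are at least 1/2,
      rounding up gives \<open>K\<close> <= 2 ln h + 1 <= 4 ln h, whence 384 = 96 * 4.\<close>
    define K where "K = nat \<lceil>log 2 (real h)\<rceil>"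
    have "log 2 (real h) \<le> 2 * ln (real h)"
    proof -
      have "ln (real h) * 1 \<le> ln (real h) * (2 * ln 2)"
        using ln_nat_ge_half[of 2] L by (intro mult_left_mono) auto
      then show ?thesis by (simp add: log_def divide_le_eq mult_ac)
    qed
    moreover have "log 2 (real h) > 0" using h by simp
    ultimately have K: "log 2 (real h) \<le> real K" "real K \<le> 4 * ln (real h)"
      unfolding K_def using L by linarith+
    have hK: "h \<le> 2 ^ K"
    proof -
      have "real h = 2 powr (log 2 (real h))" using h by simp
      also have "\<dots> \<le> 2 powr (real K)" using K by (intro powr_mono) auto
      finally have "real h \<le> real (2 ^ K)" by (simp add: powr_realpow)
      then show ?thesis by (simp only: of_nat_le_iff)
    qed
    have zh: "z < h \<and> z \<ge> 1 \<and> y \<le> z" if "z \<in> B" for z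
    proof -
      have "z \<le> g * z" using g by simp
      moreover have "g * z < h" "z \<in> Z" using that by (auto simp: B_def)
      ultimately show ?thesis using Z(2)[of z] y by linarith
    qed
    have "(\<Sum>z\<in>B. ?S z) \<le> 96 * real K * ?\<rho> ^ 2 * real g * sqrt (real h)"
    proof (rule sum_admissible_dyadic_le)
      show "?\<rho> > 0" using L by simp
      show "real z / real (totient z) \<le> ?\<rho>" if "z \<in> B" for z
        using zh[OF that] h by (intro ratio_totient_le) auto
      show "y \<le> z \<and> z < 2 ^ K" if "z \<in> B" for z using zh[OF that] hK by linarith
    qed (use h g y cy Z in \<open>auto simp: B_def\<close>)
    also have "\<dots> \<le> 96 * (4 * ln (real h)) * ?\<rho> ^ 2 * real g * sqrt (real h)"
      using K by (intro mult_right_mono mult_left_mono) auto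
    finally show ?thesis .
  qed
  finally show ?thesis by (simp add: algebra_simps)
qed

lemma squarefree_mult_imp_coprime:
  fixes a b :: nat
  assumes "squarefree (a * b)"
  shows "coprime a b"
proof (rule coprimeI)
  fix c assume "c dvd a" "c dvd b"
  then have "c ^ 2 dvd a * b" by (simp add: power2_eq_square mult_dvd_mono)
  then show "is_unit c" using assms squarefreeD by blast
qed

text \<open>Because phi(n) <= n. It lets x, y and z share the divisor sum that g requires.\<close>

lemma ratio_totient_square_le_cube:
  "real n / real (totient n) ^ 2 \<le> real n ^ 2 / real (totient n) ^ 3"
proof (cases "n = 0")
  case False
  then have "real n / real (totient n) ^ 2 = real n * real (totient n) / real (totient n) ^ 3"
    by (simp add: power2_eq_square power3_eq_cube)
  also have "\<dots> \<le> real n * real n / real (totient n) ^ 3"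
    using totient_le[of n] by (intro divide_right_mono mult_left_mono) auto
  finally show ?thesis by (simp add: power2_eq_square)
qed simp

text \<open>The totients multiply to phi(g)^3 (phi(x) phi(y) phi(z))^2. The sum over z and a_1
  yields g sqrt h, the sum over a_3 yields 12 gxy sqrt h; together they leave h g^2 x y / (phi(g)^3
  phi(x)^2 phi(y)^2), a product of convergent-type weights in g, x, y.\<close>

lemma sum_parametrized_sum_le:
  fixes q h g x y :: nat
  assumes h: "h \<ge> 2" and q: "q > 0"
    and M: "(\<Sum>d | d dvd q. real d ^ 2 / real (totient d) ^ 3) \<le> M"
  shows "(\<Sum>z | z dvd q. parametrized_sum h g x y z) \<le>
    (real g ^ 2 / real (totient g) ^ 3) * (real x ^ 2 / real (totient x) ^ 3) * (real y ^ 2 / real (totient y) ^ 3) *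
    (12 * real h * (14 * M + 384 * ln (real h) * (exp 13 * ln (ln (real h) + 3)) ^ 2))"
    (is "_ \<le> ?W * (12 * real h * ?B)")
proof -
  have B: "?B \<ge> 0"
  proof -
    have "0 \<le> (\<Sum>d | d dvd q. real d ^ 2 / real (totient d) ^ 3)" by (intro sum_nonneg) simp
    moreover have "ln (real h) \<ge> 1 / 2" by (rule ln_nat_ge_half[OF h])
    ultimately show ?thesis using M by (intro add_nonneg_nonneg mult_nonneg_nonneg) auto
  qed
  let ?q3 = "g * x * y"
  show ?thesis
  proof (cases "squarefree ?q3 \<and> ?q3 > 1")
    case False
    then have "(\<Sum>z | z dvd q. parametrized_sum h g x y z) = 0"
      by (intro sum.neutral) (auto simp: parametrized_sum_def)
    then show ?thesis using B by simp
  next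
    case True
    then have pos: "g > 0" "x > 0" "y > 0" by (auto intro!: Nat.gr0I)
    have xy: "coprime x y"
      using True squarefree_mult_imp_coprime[of x y] squarefree_mono[of "x * y" ?q3] by (auto simp: mult.assoc)
    define Z where "Z = {z. z dvd q \<and> squarefree (g * y * z) \<and> squarefree (g * x * z)
      \<and> g * y * z > 1 \<and> g * x * z > 1 \<and> y \<le> z}"
    have fin: "finite {z. z dvd q}" using q by simp
    have finZ: "finite Z" by (rule finite_subset[OF _ fin]) (auto simp: Z_def)
    let ?C = "{c. c \<in> {0<..<?q3} \<and> coprime c y}"
    let ?c = "1 / (real (totient g) ^ 3 * real (totient x) ^ 2 * real (totient y) ^ 2)"
    let ?A = "\<lambda>c z. \<Sum>a\<in>admissible g x y z c. psi (expsum_bound h (g * y * z) a)"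
    have finC: "finite ?C" by (rule finite_subset[of _ "{0<..<?q3}"]) auto
    have "(\<Sum>z | z dvd q. parametrized_sum h g x y z) = (\<Sum>z\<in>Z. parametrized_sum h g x y z)"
      by (rule sum.mono_neutral_right) (use fin in \<open>auto simp: Z_def parametrized_sum_def\<close>)
    also have "\<dots> \<le> (\<Sum>z\<in>Z. \<Sum>c\<in>?C. ?c * (psi (expsum_bound h ?q3 c) * (1 / real (totient z) ^ 2 * ?A c z)))"
    proof (rule sum_mono)
      fix z assume z: "z \<in> Z"
      have tot3: "totient (a * b * c) = totient a * totient b * totient c"
        if sf: "squarefree (a * b * c)" for a b c
      proof -
        have "coprime (a * b) c" "coprime a b"
          using squarefree_mult_imp_coprime[OF sf] squarefree_mult_imp_coprime[of a b] squarefree_mono[OF _ sf, of "a * b"]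
          by auto
        then show ?thesis by (simp add: totient_mult_coprime)
      qed
      have t: "totient (g * y * z) = totient g * totient y * totient z"
        "totient (g * x * z) = totient g * totient x * totient z"
        "totient (g * x * y) = totient g * totient x * totient y"
        using z True by (auto intro!: tot3 simp: Z_def)
      have "parametrized_sum h g x y z = pair_sum h (g * y * z) (g * x * z) ?q3 /
        (real (totient (g * y * z)) * real (totient (g * x * z)) * real (totient ?q3))"
        using z True by (simp add: parametrized_sum_def Z_def)
      also have "\<dots> \<le> (\<Sum>c\<in>?C. psi (expsum_bound h ?q3 c) * ?A c z) /
        (real (totient (g * y * z)) * real (totient (g * x * z)) * real (totient ?q3))"
        using z True by (intro divide_right_mono pair_sum_parametrized_le) (auto simp: Z_def)
      also have "\<dots> = ?c * (1 / real (totient z) ^ 2) * (\<Sum>c\<in>?C. psi (expsum_bound h ?q3 c) * ?A c z)"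
        unfolding t by (simp add: power2_eq_square power3_eq_cube mult_ac)
      also have "\<dots> = (\<Sum>c\<in>?C. ?c * (psi (expsum_bound h ?q3 c) * (1 / real (totient z) ^ 2 * ?A c z)))"
        unfolding sum_distrib_left[of _ _ ?C] by (intro sum.cong refl) (simp only: mult_ac)
      finally show "parametrized_sum h g x y z \<le>
        (\<Sum>c\<in>?C. ?c * (psi (expsum_bound h ?q3 c) * (1 / real (totient z) ^ 2 * ?A c z)))" .
    qed
    also have "\<dots> = (\<Sum>c\<in>?C. \<Sum>z\<in>Z. ?c * (psi (expsum_bound h ?q3 c) * (1 / real (totient z) ^ 2 * ?A c z)))"
      by (rule sum.swap)
    also have "\<dots> = (\<Sum>c\<in>?C. ?c * (psi (expsum_bound h ?q3 c) * (\<Sum>z\<in>Z. 1 / real (totient z) ^ 2 * ?A c z)))"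
      by (simp only: sum_distrib_left)
    also have "\<dots> \<le> (\<Sum>c\<in>?C. ?c * (psi (expsum_bound h ?q3 c) * (real g * sqrt (real h) * ?B)))"
    proof (intro sum_mono mult_left_mono)
      fix c assume c: "c \<in> ?C"
      show "(\<Sum>z\<in>Z. 1 / real (totient z) ^ 2 * ?A c z) \<le> real g * sqrt (real h) * ?B"
      proof (rule sum_inner_le)
        fix A assume "A \<subseteq> Z"
        have "(\<Sum>z\<in>A. real z / real (totient z) ^ 2) \<le> (\<Sum>z\<in>A. real z ^ 2 / real (totient z) ^ 3)"
          by (intro sum_mono ratio_totient_square_le_cube)
        also have "\<dots> \<le> (\<Sum>d | d dvd q. real d ^ 2 / real (totient d) ^ 3)"
          by (rule sum_mono2) (use fin \<open>A \<subseteq> Z\<close> in \<open>auto simp: Z_def\<close>)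
        finally show "(\<Sum>z\<in>A. real z / real (totient z) ^ 2) \<le> M" using M by simp
      qed (use h pos xy c finZ in \<open>auto simp: Z_def\<close>)
    qed auto
    also have "\<dots> = ?c * (real g * sqrt (real h) * ?B) * (\<Sum>c\<in>?C. psi (expsum_bound h ?q3 c))"
      unfolding sum_distrib_left by (intro sum.cong refl) (simp only: mult_ac)
    also have "\<dots> \<le> ?c * (real g * sqrt (real h) * ?B) * (12 * real ?q3 * sqrt (real h))"
    proof (rule mult_left_mono)
      have "(\<Sum>c\<in>?C. psi (expsum_bound h ?q3 c)) \<le> (\<Sum>c\<in>{0<..<?q3}. psi (expsum_bound h ?q3 c))"
        by (rule sum_mono2) auto
      also have "\<dots> \<le> 12 * real ?q3 * sqrt (real h)"
        using h pos by (intro sum_psi_expsum_bound_le) auto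
      finally show "(\<Sum>c\<in>?C. psi (expsum_bound h ?q3 c)) \<le> 12 * real ?q3 * sqrt (real h)" .
    qed (use B in \<open>auto intro!: mult_nonneg_nonneg\<close>)
    also have "\<dots> = ?c * (real g ^ 2 * (real x * real y)) * (12 * (sqrt (real h) * sqrt (real h)) * ?B)"
      by (simp add: power2_eq_square mult_ac)
    also have "\<dots> = ?c * (real g ^ 2 * (real x * real y)) * (12 * real h * ?B)" by simp
    also have "\<dots> \<le> ?W * (12 * real h * ?B)"
    proof (rule mult_right_mono)
      have "?c * (real g ^ 2 * (real x * real y)) =
          real g ^ 2 / real (totient g) ^ 3 * (real x / real (totient x) ^ 2) * (real y / real (totient y) ^ 2)"
        by simp
      also have "\<dots> \<le> ?W" by (intro mult_mono ratio_totient_square_le_cube) auto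
      finally show "?c * (real g ^ 2 * (real x * real y)) \<le> ?W" .
    qed (use B in auto)
    finally show ?thesis .
  qed
qed

section \<open>From ln(ln h + 3) back to ln ln h, and the final estimate\<close>

text \<open>ln ln h vanishes only at e, which is no integer since 2 < e < 3. So the finitely many h
  < 27 are absorbed into the constant, and for h >= 27 > e^3 one has ln h + 3 <= (ln h)^2.\<close>

lemma ln_ln_add_3_le:
  "\<exists>c>0. \<forall>h\<ge>2. ln (ln (real h) + 3) \<le> c * \<bar>ln (ln (real h))\<bar>"
proof -
  let ?a = "\<lambda>h::nat. ln (ln (real h) + 3)" and ?b = "\<lambda>h::nat. \<bar>ln (ln (real h))\<bar>"
  \<comment> \<open>The bounds on e come from exp u >= 1 + u at u = 1/2 and u = -1/8: (3/2)^2 > 2,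
    and (7/8)^8 > 1/3 bounds 1/e from below.\<close>
  have e2: "exp 1 > (2::real)"
  proof -
    have "(1 + 1 / 2) ^ 2 \<le> exp (1 / 2 :: real) ^ 2"
      by (intro power_mono exp_ge_add_one_self) auto
    then show ?thesis by (simp add: power2_eq_square flip: exp_add)
  qed
  have e3: "exp 1 < (3::real)"
  proof -
    have "1 + (- (1 / 8)) \<le> exp (- (1 / 8) :: real)" by (rule exp_ge_add_one_self)
    then have "(7 / 8) ^ 8 \<le> exp (- (1 / 8) :: real) ^ 8" by (intro power_mono) auto
    also have "\<dots> = exp (- 1)" by (simp flip: exp_of_nat_mult)
    finally have "1 / 3 < exp (- 1 :: real)" by (simp add: eval_nat_numeral)
    then show ?thesis by (simp add: exp_minus field_simps)
  qed
  have b: "?b h > 0" if "h \<ge> 2" for h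
  proof -
    have "ln (real h) \<noteq> 1"
    proof
      assume "ln (real h) = 1"
      then have "real h = exp 1" using that by (metis exp_ln of_nat_0_less_iff less_le_trans pos2)
      then have "2 < real h" "real h < 3" using e2 e3 by auto
      then show False by simp
    qed
    moreover have "ln (real h) > 0" using that by simp
    ultimately show ?thesis by simp
  qed
  define c where "c = 2 + (\<Sum>h\<in>{2..<27}. ?a h / ?b h)"
  have a: "?a h \<ge> 0" if "h \<ge> 2" for h
    using ln_nat_ge_half[OF that] by simp
  have s: "(\<Sum>h\<in>{2..<27}. ?a h / ?b h) \<ge> 0" using a b by (intro sum_nonneg) auto
  have "?a h \<le> c * ?b h" if "h \<ge> 2" for h
  proof (cases "h < 27")
    case True
    have "?a h / ?b h \<le> (\<Sum>h\<in>{2..<27}. ?a h / ?b h)"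
      by (rule member_le_sum) (use True that a in auto)
    then have "?a h / ?b h \<le> c" by (simp add: c_def)
    then show ?thesis using b[OF that] by (simp add: divide_le_eq)
  next
    case False
    have "exp 3 = exp (1::real) ^ 3" by (simp flip: exp_of_nat_mult)
    also have "\<dots> \<le> 3 ^ 3" using e3 by (intro power_mono) auto
    also have "\<dots> \<le> real h" using False by simp
    finally have "ln (exp 3) \<le> ln (real h)" by (intro ln_mono) auto
    then have L: "ln (real h) \<ge> 3" by simp
    have "3 * ln (real h) \<le> ln (real h) * ln (real h)" using L by (intro mult_right_mono) auto
    then have "ln (real h) + 3 \<le> ln (real h) ^ 2" unfolding power2_eq_square using L by linarith
    then have "?a h \<le> ln (ln (real h) ^ 2)" using L by (intro ln_mono) auto
    also have "\<dots> = 2 * ln (ln (real h))" using L by (simp add: ln_realpow)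
    also have "\<dots> \<le> 2 * ?b h" by simp
    also have "\<dots> \<le> c * ?b h" using s by (intro mult_right_mono) (auto simp: c_def)
    finally show ?thesis .
  qed
  moreover have "c > 0" using s by (simp add: c_def)
  ultimately show ?thesis by blast
qed

theorem theorem2p1:
  "\<exists>C::real. \<forall>h::nat. \<forall>q::nat.
     h \<ge> 2 \<longrightarrow> q = \<Prod>{p::nat. prime p \<and> p \<le> h ^ 4} \<longrightarrow>
     norm (V3 q h) \<le> C * (real h * ln (real h) ^ 4 * ln (ln (real h)) ^ 2)"
proof -
  obtain c where c: "c > 0" "\<And>h::nat. h \<ge> 2 \<Longrightarrow> ln (ln (real h) + 3) \<le> c * \<bar>ln (ln (real h))\<bar>"
    using ln_ln_add_3_le by blast
  \<comment> \<open>The factor 4 is from ln(h^4) = 4 ln h.\<close>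
  define m :: real where "m = 4 * exp 39"
  \<comment> \<open>The outer 12 counts permutations, \<open>m ^ 3\<close> comes from g, x and y,
    the inner bracket from z and the numerators, and \<open>c ^ 2\<close> from the comparison of
    iterated logarithms.\<close>
  define C where "C = 12 * (m ^ 3 * (12 * (14 * m + 384 * exp 13 ^ 2))) * c ^ 2"
  have "norm (V3 q h) \<le> C * (real h * ln (real h) ^ 4 * ln (ln (real h)) ^ 2)"
    if h: "h \<ge> 2" and q: "q = \<Prod>{p::nat. prime p \<and> p \<le> h ^ 4}" for h q :: nat
  proof -
    have qP: "q = \<Prod>(primes_upto (h ^ 4))" by (simp add: q primes_upto_def)
    have q0: "q > 0" unfolding qP by (rule primorial_pos)
    have sf: "squarefree q" unfolding qP
      by (rule squarefree_prod_coprime) (auto dest!: primes_uptoD intro!: primes_coprime squarefree_prime)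
    let ?L = "ln (real h)" and ?l = "ln (ln (real h) + 3)"
    have L: "?L \<ge> 1 / 2" by (rule ln_nat_ge_half[OF h])
    \<comment> \<open>This lets the divisor-sum term be multiplied by \<open>?l ^ 2\<close>, so that
      both cases for gz take one shape.\<close>
    have l: "?l \<ge> 1"
    proof -
      have "exp 1 \<le> ?L + 3" using exp_le L by linarith
      then have "ln (exp 1) \<le> ?l" by (intro ln_mono) auto
      then show ?thesis by simp
    qed
    define M where "M = m * ?L"
    let ?f = "\<lambda>d. real d ^ 2 / real (totient d) ^ 3"
    have M: "(\<Sum>d | d dvd q. ?f d) \<le> M"
    proof -
      have "2 \<le> h ^ 4" using h self_le_power[of h 4] by linarith
      then have "(\<Sum>d | d dvd q. ?f d) \<le> exp 39 * ln (real (h ^ 4))"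
        unfolding qP by (rule sum_divisors_primorial_le)
      then show ?thesis using h by (simp add: M_def m_def ln_realpow)
    qed
    let ?K = "12 * real h * (14 * M + 384 * ?L * (exp 13 * ?l) ^ 2)"
    have M0: "M \<ge> 0" using L by (simp add: M_def m_def)
    have K0: "?K \<ge> 0" using M0 L by simp
    have K: "?K \<le> 12 * (14 * m + 384 * exp 13 ^ 2) * (real h * ?L * ?l ^ 2)"
    proof -
      have "M * 1 \<le> M * ?l ^ 2" using M0 l by (intro mult_left_mono one_le_power) auto
      then have "12 * real h * (14 * M + 384 * ?L * (exp 13 * ?l) ^ 2)
          \<le> 12 * real h * (14 * (M * ?l ^ 2) + 384 * ?L * (exp 13 * ?l) ^ 2)"
        by (intro mult_left_mono add_mono) (use L in auto)
      also have "\<dots> = 12 * (14 * m + 384 * exp 13 ^ 2) * (real h * ?L * ?l ^ 2)"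
        unfolding M_def by (simp only: power_mult_distrib) (simp add: algebra_simps)
      finally show ?thesis .
    qed
    have "norm (V3 q h) \<le> 12 * (\<Sum>q1\<in>nontrivial_divisors q. \<Sum>q2\<in>nontrivial_divisors q.
        \<Sum>q3\<in>nontrivial_divisors q. weighted_pair_sum h q1 q2 q3)"
      using h by (intro norm_V3_le_weighted_pair_sums) auto
    also have "\<dots> \<le> 12 * (\<Sum>g | g dvd q. \<Sum>x | x dvd q. \<Sum>y | y dvd q. \<Sum>z | z dvd q. parametrized_sum h g x y z)"
      by (intro mult_left_mono sum_weighted_pair_sum_le sf) auto
    also have "\<dots> \<le> 12 * (\<Sum>g | g dvd q. \<Sum>x | x dvd q. \<Sum>y | y dvd q. ?f g * ?f x * ?f y * ?K)"
      by (intro mult_left_mono sum_mono sum_parametrized_sum_le h q0 M) auto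
    also have "\<dots> = 12 * ((\<Sum>d | d dvd q. ?f d) ^ 3 * ?K)"
      by (simp only: power3_eq_cube sum_distrib_left[symmetric] sum_distrib_right[symmetric])
    also have "\<dots> \<le> 12 * (M ^ 3 * ?K)"
      by (intro mult_left_mono mult_right_mono power_mono M K0 sum_nonneg) auto
    also have "\<dots> \<le> 12 * (M ^ 3 * (12 * (14 * m + 384 * exp 13 ^ 2) * (real h * ?L * ?l ^ 2)))"
      by (intro mult_left_mono K) (use M0 in auto)
    also have "\<dots> \<le> 12 * (M ^ 3 * (12 * (14 * m + 384 * exp 13 ^ 2) * (real h * ?L * (c * \<bar>ln ?L\<bar>) ^ 2)))"
      by (intro mult_left_mono power_mono c h) (use M0 l L in \<open>auto simp: m_def\<close>)
    also have "\<dots> = C * (real h * ?L ^ 4 * ln ?L ^ 2)"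
      by (simp add: C_def M_def power_mult_distrib eval_nat_numeral mult_ac)
    finally show ?thesis .
  qed
  then show ?thesis by blast
qed

end
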